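(* Let $N\ge2$ be an integer. The $\mathbb Q$-vector space $\mathcal M_2^-(\mathbb Z/N\mathbb Z)\otimes\mathbb Q$ is isomorphic to $\mathbb M_2^-(\Gamma_1(N))$.
   Context: Identify the character group of $\mathbb Z/N\mathbb Z$ with $\mathbb Z/N\mathbb Z$. $\mathcal M_2^-(\mathbb Z/N\mathbb Z)$ is the $\mathbb Z$-module generated by symbols $\langle a_1,a_2\rangle^-$ with $a_1,a_2\in\mathbb Z/N\mathbb Z$, $\gcd(a_1,a_2,N)=1$, subject to the relations $\langle a_1,a_2\rangle^-=\langle a_2,a_1\rangle^-$, $\langle a_1,a_2\rangle^-=\langle a_1,a_2-a_1\rangle^-+\langle a_1-a_2,a_2\rangle^-$, and $\langle-a_1,a_2\rangle^-=-\langle a_1,a_2\rangle^-$, for all such $a_1,a_2$. $\mathbb M_2(\Gamma_1(N))$ (modular symbols of weight 2 for $\Gamma_1(N)$) is the $\mathbb Q$-vector space generated by pairs $(c,d)$ with $c,d\in\mathbb Z/N\mathbb Z$, $\gcd(c,d,N)=1$, subject to the relations $(c,d)=-(d,-c)$ and $(c,d)+(d,-c-d)+(-c-d,c)=0$. There is an involution $\iota$ on $\mathbb M_2(\Gamma_1(N))$ given by $(c,d)\mapsto(-c,d)=-(d,c)$, and $\mathbb M_2^-(\Gamma_1(N))$ is its $(-1)$-eigenspace. *)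

theory Defs
  imports
    "HOL-Library.Poly_Mapping"
    "HOL-Algebra.Algebraic_Closure_Type"
    "HOL-Number_Theory.Residues"
    "Jordan_Normal_Form.Missing_VectorSpace"
begin

section \<open>Modules given by generators and relations\<close>

text \<open>
  The records of type \<^typ>\<open>('r, 'm) module\<close> below are modules only: their ring
  multiplication and unit are never used, hence \<^const>\<open>undefined\<close>.
\<close>

definition free_module :: "'x set \<Rightarrow> ('r :: comm_ring_1, 'x \<Rightarrow>\<^sub>0 'r) module" where
  "free_module S =
    \<lparr>carrier = {f. Poly_Mapping.keys f \<subseteq> S}, monoid.mult = undefined, one = undefined,
     zero = 0, add = (+), Module.module.smult = (\<lambda>r. Poly_Mapping.map ((*) r))\<rparr>"

abbreviation gen :: "'x \<Rightarrow> 'x \<Rightarrow>\<^sub>0 'r :: comm_ring_1" where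
  "gen x \<equiv> Poly_Mapping.single x 1"

text \<open>The linear map between free modules that extends a map \<open>g\<close> of their bases.\<close>

definition free_map :: "('x \<Rightarrow> 'y) \<Rightarrow> ('x \<Rightarrow>\<^sub>0 'r :: comm_ring_1) \<Rightarrow> ('y \<Rightarrow>\<^sub>0 'r)" where
  "free_map g f = (\<Sum>x\<in>Poly_Mapping.keys f. Poly_Mapping.single (g x) (Poly_Mapping.lookup f x))"

text \<open>
  The endomap of \<open>M/H\<close> induced by an endomorphism \<open>\<phi>\<close> of \<open>M\<close> with \<open>\<phi> H \<subseteq> H\<close>;
  it sends the coset of \<open>x\<close> to the coset of \<open>\<phi> x\<close>, see \<open>quot_map_coset\<close> below.
\<close>

definition quot_map ::
  "('m, 'z) ring_scheme \<Rightarrow> 'm set \<Rightarrow> ('m \<Rightarrow> 'm) \<Rightarrow> 'm set \<Rightarrow> 'm set" where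
  "quot_map M H \<phi> C = (\<Union>x\<in>C. H +>\<^bsub>M\<^esub> \<phi> x)"

definition quot_module :: "('r, 'm) module \<Rightarrow> 'm set \<Rightarrow> ('r, 'm set) module" where
  "quot_module M H =
    \<lparr>carrier = a_rcosets\<^bsub>M\<^esub> H, monoid.mult = undefined, one = undefined,
     zero = H, add = set_add M, Module.module.smult = (\<lambda>r. quot_map M H (\<lambda>x. r \<odot>\<^bsub>M\<^esub> x))\<rparr>"

definition rel_span :: "'x set \<Rightarrow> ('x \<Rightarrow>\<^sub>0 'r) set \<Rightarrow> ('x \<Rightarrow>\<^sub>0 'r :: comm_ring_1) set" where
  "rel_span S rels = LinearCombinations.module.span ring_of_type_algebra (free_module S) rels"

definition presented_module ::
  "'x set \<Rightarrow> ('x \<Rightarrow>\<^sub>0 'r :: comm_ring_1) set \<Rightarrow> ('r, ('x \<Rightarrow>\<^sub>0 'r) set) module" where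
  "presented_module S rels = quot_module (free_module S) (rel_span S rels)"

section \<open>Extension of scalars from the integers to the rationals\<close>

definition tensor_gens :: "(int, 'm) module \<Rightarrow> ('m \<times> rat) set" where
  "tensor_gens M = carrier M \<times> UNIV"

definition tensor_rels :: "(int, 'm) module \<Rightarrow> ('m \<times> rat \<Rightarrow>\<^sub>0 int) set" where
  "tensor_rels M =
     {gen (x \<oplus>\<^bsub>M\<^esub> y, q) - gen (x, q) - gen (y, q) | x y q. x \<in> carrier M \<and> y \<in> carrier M}
   \<union> {gen (x, q + r) - gen (x, q) - gen (x, r) | x q r. x \<in> carrier M}
   \<union> {gen (n \<odot>\<^bsub>M\<^esub> x, q) - gen (x, of_int n * q) | n x q. x \<in> carrier M}"

text \<open>
  The additive structure is that of the tensor product of \<open>M\<close> and the rationals over the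
  integers; the rationals act on the second factor, see \<open>tensor_rat_smult_coset\<close> below.
\<close>

definition tensor_rat :: "(int, 'm) module \<Rightarrow> (rat, ('m \<times> rat \<Rightarrow>\<^sub>0 int) set) module" where
  "tensor_rat M =
    (let T = presented_module (tensor_gens M) (tensor_rels M) in
     \<lparr>carrier = carrier T, monoid.mult = undefined, one = undefined, zero = zero T, add = add T,
      Module.module.smult = (\<lambda>q. quot_map (free_module (tensor_gens M) :: (int, 'm \<times> rat \<Rightarrow>\<^sub>0 int) module)
                 (rel_span (tensor_gens M) (tensor_rels M)) (free_map (\<lambda>(x, r). (x, q * r))))\<rparr>)"

section \<open>The two spaces of symbols\<close>

abbreviation ZN :: "nat \<Rightarrow> int ring" where
  "ZN N \<equiv> residue_ring (int N)"

definition symbols :: "nat \<Rightarrow> (int \<times> int) set" where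
  "symbols N = {(a, b). a \<in> carrier (ZN N) \<and> b \<in> carrier (ZN N) \<and> gcd (gcd a b) (int N) = 1}"

definition M2_minus_rels :: "nat \<Rightarrow> (int \<times> int \<Rightarrow>\<^sub>0 int) set" where
  "M2_minus_rels N =
     {gen (a, b) - gen (b, a) | a b. (a, b) \<in> symbols N}
   \<union> {gen (a, b) - (gen (a, b \<ominus>\<^bsub>ZN N\<^esub> a) + gen (a \<ominus>\<^bsub>ZN N\<^esub> b, b)) | a b. (a, b) \<in> symbols N}
   \<union> {gen (\<ominus>\<^bsub>ZN N\<^esub> a, b) - (- gen (a, b)) | a b. (a, b) \<in> symbols N}"

definition M2_minus :: "nat \<Rightarrow> (int, (int \<times> int \<Rightarrow>\<^sub>0 int) set) module" where
  "M2_minus N = presented_module (symbols N) (M2_minus_rels N)"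

definition modsym_rels :: "nat \<Rightarrow> (int \<times> int \<Rightarrow>\<^sub>0 rat) set" where
  "modsym_rels N =
     {gen (c, d) - (- gen (d, \<ominus>\<^bsub>ZN N\<^esub> c)) | c d. (c, d) \<in> symbols N}
   \<union> {gen (c, d) + gen (d, \<ominus>\<^bsub>ZN N\<^esub> c \<ominus>\<^bsub>ZN N\<^esub> d) + gen (\<ominus>\<^bsub>ZN N\<^esub> c \<ominus>\<^bsub>ZN N\<^esub> d, c)
       | c d. (c, d) \<in> symbols N}"

definition modsym :: "nat \<Rightarrow> (rat, (int \<times> int \<Rightarrow>\<^sub>0 rat) set) module" where
  "modsym N = presented_module (symbols N) (modsym_rels N)"

text \<open>
  The involution induced by \<open>(c, d) \<mapsto> (-c, d)\<close>, see \<open>modsym_iota_coset\<close> below.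
\<close>

definition modsym_iota :: "nat \<Rightarrow> (int \<times> int \<Rightarrow>\<^sub>0 rat) set \<Rightarrow> (int \<times> int \<Rightarrow>\<^sub>0 rat) set" where
  "modsym_iota N =
     quot_map (free_module (symbols N) :: (rat, int \<times> int \<Rightarrow>\<^sub>0 rat) module)
       (rel_span (symbols N) (modsym_rels N)) (free_map (\<lambda>(c, d). (\<ominus>\<^bsub>ZN N\<^esub> c, d)))"

definition modsym_minus :: "nat \<Rightarrow> (rat, (int \<times> int \<Rightarrow>\<^sub>0 rat) set) module" where
  "modsym_minus N = (modsym N)
     \<lparr>carrier := {C \<in> carrier (modsym N). modsym_iota N C = \<ominus>\<^bsub>modsym N\<^esub> C}\<rparr>"

section \<open>Well-definedness\<close>

lemma lookup_scale:
  "Poly_Mapping.lookup (Poly_Mapping.map ((*) c) f) x = (c :: 'r :: comm_ring_1) * Poly_Mapping.lookup f x"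
  by (auto simp: Poly_Mapping.map.rep_eq when_def)

lemma free_map_superset:
  assumes "finite A" "Poly_Mapping.keys f \<subseteq> A"
  shows "free_map g f = (\<Sum>x\<in>A. Poly_Mapping.single (g x) (Poly_Mapping.lookup f x))"
  unfolding free_map_def by (intro sum.mono_neutral_left) (use assms in \<open>auto simp: in_keys_iff\<close>)

lemma free_map_zero [simp]: "free_map g 0 = 0"
  by (simp add: free_map_def)

lemma free_map_single [simp]: "free_map g (Poly_Mapping.single x c) = Poly_Mapping.single (g x) c"
  by (simp add: free_map_def)

lemma free_map_add: "free_map g (p + q) = free_map g p + free_map g q"
proof -
  let ?A = "Poly_Mapping.keys p \<union> Poly_Mapping.keys q"
  have "Poly_Mapping.keys (p + q) \<subseteq> ?A" by (rule Poly_Mapping.keys_add)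
  then show ?thesis
    by (simp add: free_map_superset[of ?A] lookup_add single_add sum.distrib)
qed

lemma free_map_uminus: "free_map g (- p) = - free_map g p"
  using free_map_add[of g p "- p"] by (simp add: eq_neg_iff_add_eq_0 add.commute)

lemma free_map_diff: "free_map g (p - q) = free_map g p - free_map g q"
  using free_map_add[of g p "- q"] by (simp add: free_map_uminus)

lemma free_map_smult:
  "free_map g (Poly_Mapping.map ((*) c) p) = Poly_Mapping.map ((*) c) (free_map g p)"
proof -
  have k: "Poly_Mapping.keys (Poly_Mapping.map ((*) c) p) \<subseteq> Poly_Mapping.keys p"
    by (auto simp: in_keys_iff Poly_Mapping.map.rep_eq when_def)
  show ?thesis
    by (rule poly_mapping_eqI)
      (simp add: lookup_scale free_map_superset[OF finite_keys k] free_map_superset[of "Poly_Mapping.keys p" p]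
         lookup_sum lookup_single sum_distrib_left when_def if_distrib cong: if_cong)
qed

lemma keys_free_map: "g ` S \<subseteq> S' \<Longrightarrow> Poly_Mapping.keys f \<subseteq> S \<Longrightarrow> Poly_Mapping.keys (free_map g f) \<subseteq> S'"
  unfolding free_map_def
  by (rule order.trans[OF Poly_Mapping.keys_sum]) (auto split: if_splits)

lemma module_free_module:
  "module ring_of_type_algebra (free_module S :: ('r :: comm_ring_1, 'x \<Rightarrow>\<^sub>0 'r) module)"
proof (rule moduleI)
  show "abelian_group (free_module S :: ('r, 'x \<Rightarrow>\<^sub>0 'r) module)"
  proof (rule abelian_groupI)
    fix x :: "'x \<Rightarrow>\<^sub>0 'r" assume "x \<in> carrier (free_module S)"
    then show "\<exists>y\<in>carrier (free_module S). y \<oplus>\<^bsub>free_module S\<^esub> x = \<zero>\<^bsub>free_module S\<^esub>"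
      by (intro bexI[of _ "- x"]) (auto simp: free_module_def)
  next
    fix x y :: "'x \<Rightarrow>\<^sub>0 'r" assume "x \<in> carrier (free_module S)" "y \<in> carrier (free_module S)"
    then show "x \<oplus>\<^bsub>free_module S\<^esub> y \<in> carrier (free_module S)"
      using Poly_Mapping.keys_add[of x y] by (auto simp: free_module_def)
  qed (auto simp: free_module_def algebra_simps)
  fix a b :: 'r and x y :: "'x \<Rightarrow>\<^sub>0 'r"
  assume "x \<in> carrier (free_module S)"
  then show "a \<odot>\<^bsub>free_module S\<^esub> x \<in> carrier (free_module S)"
    by (force simp: free_module_def in_keys_iff lookup_scale)
qed (auto simp: free_module_def ring_of_type_algebra_def lookup_scale lookup_add algebra_simps
      intro!: poly_mapping_eqI cring_from_type_algebra[unfolded ring_of_type_algebra_def])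

lemma abelian_subgroup_rel_span:
  fixes rels :: "('x \<Rightarrow>\<^sub>0 'r :: comm_ring_1) set"
  assumes "rels \<subseteq> carrier (free_module S)"
  shows "abelian_subgroup (rel_span S rels) (free_module S :: ('r, 'x \<Rightarrow>\<^sub>0 'r) module)"
proof -
  interpret module "ring_of_type_algebra :: 'r ring" "free_module S :: ('r, 'x \<Rightarrow>\<^sub>0 'r) module"
    by (rule module_free_module)
  have sm: "submodule ring_of_type_algebra (rel_span S rels) (free_module S)"
    unfolding rel_span_def by (rule span_is_submodule[OF assms])
  have "module ring_of_type_algebra ((free_module S :: ('r, 'x \<Rightarrow>\<^sub>0 'r) module)\<lparr>carrier := rel_span S rels\<rparr>)"
    by (rule submodule_is_module[OF sm])
  then have "Module.submodule (rel_span S rels) ring_of_type_algebra (free_module S :: ('r, 'x \<Rightarrow>\<^sub>0 'r) module)"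
    by (intro module_incl_imp_submodule submodule.subset[OF sm])
  then show ?thesis
    by (intro abelian_subgroupI3 additive_subgroupI Module.submodule.axioms(1)) (auto intro: abelian_group_axioms)
qed

lemma rels_in_rel_span:
  fixes rels :: "('x \<Rightarrow>\<^sub>0 'r :: comm_ring_1) set"
  assumes "rels \<subseteq> carrier (free_module S)"
  shows "rels \<subseteq> rel_span S rels"
proof -
  interpret module "ring_of_type_algebra :: 'r ring" "free_module S :: ('r, 'x \<Rightarrow>\<^sub>0 'r) module"
    by (rule module_free_module)
  show ?thesis unfolding rel_span_def using in_own_span[OF assms] .
qed

lemma quot_map_coset:
  fixes M (structure)
  assumes "abelian_subgroup H M" and x: "x \<in> carrier M"
    and "\<phi> \<in> carrier M \<rightarrow> carrier M"
    and "\<And>x y. x \<in> carrier M \<Longrightarrow> y \<in> carrier M \<Longrightarrow> \<phi> (x \<oplus> y) = \<phi> x \<oplus> \<phi> y"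
    and "\<phi> ` H \<subseteq> H"
  shows "quot_map M H \<phi> (H +> x) = H +> \<phi> x"
proof -
  interpret abelian_subgroup H M by fact
  have "H +> \<phi> y = H +> \<phi> x" if "y \<in> H +> x" for y
  proof -
    from that obtain h where h: "h \<in> H" "y = h \<oplus> x" by (auto simp: a_r_coset_def')
    then have "\<phi> y = \<phi> h \<oplus> \<phi> x" "\<phi> h \<in> H" using assms a_subset by auto
    then show ?thesis using assms x
      by (metis PiE a_rcosI a_repr_independence' a_r_coset_def' UN_iff singletonI)
  qed
  moreover have "x \<in> H +> x" using x by (rule a_rcos_self)
  ultimately show ?thesis unfolding quot_map_def by blast
qed

lemma free_map_rel_span:
  fixes rels :: "('x \<Rightarrow>\<^sub>0 'r :: comm_ring_1) set"
  assumes rels: "rels \<subseteq> carrier (free_module S)" and g: "g ` S \<subseteq> S"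
    and "\<And>f. f \<in> rels \<Longrightarrow> free_map g f \<in> rel_span S rels"
  shows "free_map g ` rel_span S rels \<subseteq> rel_span S rels"
proof -
  interpret module "ring_of_type_algebra :: 'r ring" "free_module S :: ('r, 'x \<Rightarrow>\<^sub>0 'r) module"
    by (rule module_free_module)
  have sm: "submodule ring_of_type_algebra (rel_span S rels) (free_module S)"
    unfolding rel_span_def by (rule span_is_submodule[OF rels])
  let ?K = "{f \<in> carrier (free_module S). free_map g f \<in> rel_span S rels}"
  have "submodule ring_of_type_algebra ?K (free_module S)"
  proof (unfold_locales, goal_cases)
    case (2 v w)
    then show ?case using submodule.m_closed[OF sm] m_closed
      using Poly_Mapping.keys_add[of v w] by (auto simp: free_module_def free_map_add)
  next
    case 3
    then show ?case using submodule.zero_closed[OF sm] by (auto simp: free_module_def)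
  next
    case (4 c v)
    then show ?case using submodule.smult_closed[OF sm, of c "free_map g v"] smult_closed[of c v]
      by (auto simp: free_module_def free_map_smult)
  qed auto
  then have "rel_span S rels \<subseteq> ?K"
    unfolding rel_span_def by (rule span_is_subset[rotated]) (use assms in \<open>auto simp: rel_span_def\<close>)
  then show ?thesis by auto
qed

lemma quot_map_free_map_coset:
  fixes rels :: "('x \<Rightarrow>\<^sub>0 'r :: comm_ring_1) set" and S :: "'x set"
  defines "F \<equiv> free_module S :: ('r, 'x \<Rightarrow>\<^sub>0 'r) module"
  assumes rels: "rels \<subseteq> carrier F" and g: "g ` S \<subseteq> S"
    and "\<And>f. f \<in> rels \<Longrightarrow> free_map g f \<in> rel_span S rels"
    and "f \<in> carrier F"
  shows "quot_map F (rel_span S rels) (free_map g) (rel_span S rels +>\<^bsub>F\<^esub> f)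
         = rel_span S rels +>\<^bsub>F\<^esub> free_map g f"
  unfolding F_def
proof (rule quot_map_coset)
  show "free_map g \<in> carrier (free_module S) \<rightarrow> carrier (free_module S)"
    using keys_free_map[OF g] by (auto simp: free_module_def)
  show "free_map g ` rel_span S rels \<subseteq> rel_span S rels"
    using assms by (intro free_map_rel_span) auto
qed (use assms abelian_subgroup_rel_span in \<open>auto simp: free_module_def free_map_add\<close>)

lemma minus_in_symbols:
  assumes "N \<ge> 2" "(a, b) \<in> symbols N"
  shows "(\<ominus>\<^bsub>ZN N\<^esub> a, b) \<in> symbols N" "(b, a) \<in> symbols N"
    "(a, b \<ominus>\<^bsub>ZN N\<^esub> a) \<in> symbols N" "(a \<ominus>\<^bsub>ZN N\<^esub> b, b) \<in> symbols N"
proof -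
  interpret residues "int N" "ZN N" by unfold_locales (use assms in auto)
  have g1: "gcd (gcd ((- a) mod int N) b) (int N) = gcd (gcd a b) (int N)"
    by (metis gcd.assoc gcd.commute gcd_neg1_int gcd_red_int)
  have g2: "gcd (gcd a ((b - a) mod int N)) (int N) = gcd (gcd a b) (int N)" for a b
    by (metis gcd.assoc gcd.commute gcd_diff1 gcd_red_int)
  have d: "x \<ominus>\<^bsub>ZN N\<^esub> y = (x - y) mod int N" for x y
    by (simp add: a_minus_def res_add_eq res_neg_eq mod_simps)
  show "(\<ominus>\<^bsub>ZN N\<^esub> a, b) \<in> symbols N" "(b, a) \<in> symbols N"
    "(a, b \<ominus>\<^bsub>ZN N\<^esub> a) \<in> symbols N" "(a \<ominus>\<^bsub>ZN N\<^esub> b, b) \<in> symbols N"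
    using assms g1 g2[of a b] g2[of b a]
    by (auto simp: symbols_def res_carrier_eq res_neg_eq d gcd.commute)
qed

lemma rel_span_closed:
  fixes rels :: "('x \<Rightarrow>\<^sub>0 'r :: comm_ring_1) set"
  assumes rels: "rels \<subseteq> carrier (free_module S)"
    and f: "f \<in> rel_span S rels" and g: "g \<in> rel_span S rels"
  shows "f + g \<in> rel_span S rels" "f - g \<in> rel_span S rels"
proof -
  interpret module "ring_of_type_algebra :: 'r ring" "free_module S :: ('r, 'x \<Rightarrow>\<^sub>0 'r) module"
    by (rule module_free_module)
  have sm: "submodule ring_of_type_algebra (rel_span S rels) (free_module S)"
    unfolding rel_span_def by (rule span_is_submodule[OF rels])
  have add: "h + k \<in> rel_span S rels" if "h \<in> rel_span S rels" "k \<in> rel_span S rels" for h k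
    using submodule.m_closed[OF sm that] by (simp add: free_module_def)
  have "- g = Poly_Mapping.map ((*) (- 1)) g"
    by (rule poly_mapping_eqI) (auto simp: Poly_Mapping.map.rep_eq when_def)
  then have "- g \<in> rel_span S rels"
    using submodule.smult_closed[OF sm _ g, of "- 1"]
    by (simp add: free_module_def ring_of_type_algebra_def)
  then show "f + g \<in> rel_span S rels" "f - g \<in> rel_span S rels"
    using add[OF f g] add[OF f, of "- g"] by auto
qed

lemma gen_in_free_module: "x \<in> S \<Longrightarrow> gen x \<in> carrier (free_module S)"
  by (simp add: free_module_def)

lemma free_module_closed:
  assumes "f \<in> carrier (free_module S)" "g \<in> carrier (free_module S)"
  shows "f + g \<in> carrier (free_module S)" "f - g \<in> carrier (free_module S)"
    "- f \<in> carrier (free_module S)"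
  using assms Poly_Mapping.keys_add[of f g] keys_diff[of f g] by (auto simp: free_module_def)

lemma ZN_symbols:
  assumes "N \<ge> 2" "(c, d) \<in> symbols N"
  shows "\<ominus>\<^bsub>ZN N\<^esub> (\<ominus>\<^bsub>ZN N\<^esub> c) = c" "\<ominus>\<^bsub>ZN N\<^esub> c \<ominus>\<^bsub>ZN N\<^esub> d = \<ominus>\<^bsub>ZN N\<^esub> d \<ominus>\<^bsub>ZN N\<^esub> c"
    "(d, \<ominus>\<^bsub>ZN N\<^esub> c \<ominus>\<^bsub>ZN N\<^esub> d) \<in> symbols N" "(\<ominus>\<^bsub>ZN N\<^esub> c \<ominus>\<^bsub>ZN N\<^esub> d, c) \<in> symbols N"
proof -
  interpret residues "int N" "ZN N" by unfold_locales (use assms in auto)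
  have cd: "c \<in> carrier (ZN N)" "d \<in> carrier (ZN N)" using assms by (auto simp: symbols_def)
  show "\<ominus>\<^bsub>ZN N\<^esub> (\<ominus>\<^bsub>ZN N\<^esub> c) = c" using cd by simp
  show comm: "\<ominus>\<^bsub>ZN N\<^esub> c \<ominus>\<^bsub>ZN N\<^esub> d = \<ominus>\<^bsub>ZN N\<^esub> d \<ominus>\<^bsub>ZN N\<^esub> c"
    using cd by (simp add: a_minus_def a_comm)
  note sym = minus_in_symbols[OF assms(1)]
  from assms show 1: "(d, \<ominus>\<^bsub>ZN N\<^esub> c \<ominus>\<^bsub>ZN N\<^esub> d) \<in> symbols N" by (meson sym)
  from assms show "(\<ominus>\<^bsub>ZN N\<^esub> c \<ominus>\<^bsub>ZN N\<^esub> d, c) \<in> symbols N" unfolding comm by (meson sym)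
qed

lemma modsym_rels_carrier:
  assumes "N \<ge> 2"
  shows "modsym_rels N \<subseteq> carrier (free_module (symbols N))"
  unfolding modsym_rels_def
  by (auto intro!: free_module_closed gen_in_free_module intro: minus_in_symbols(2)[OF assms]
      simp: minus_in_symbols(1)[OF assms] ZN_symbols(3,4)[OF assms])

lemma iota_modsym_rels:
  assumes N: "N \<ge> 2" and f: "f \<in> modsym_rels N"
  shows "free_map (\<lambda>(c, d). (\<ominus>\<^bsub>ZN N\<^esub> c, d)) f \<in> rel_span (symbols N) (modsym_rels N)"
proof -
  let ?H = "rel_span (symbols N) (modsym_rels N)"
  let ?n = "\<lambda>c. \<ominus>\<^bsub>ZN N\<^esub> c"
  note cl = rel_span_closed[OF modsym_rels_carrier[OF N]]
  note sym = minus_in_symbols[OF N] ZN_symbols(3,4)[OF N]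
  have R: "f \<in> ?H" if "f \<in> modsym_rels N" for f
    using rels_in_rel_span[OF modsym_rels_carrier[OF N]] that by blast
  have R1: "gen (c, d) + gen (d, ?n c) \<in> ?H" if "(c, d) \<in> symbols N" for c d
    by (rule R) (use that in \<open>force simp: modsym_rels_def\<close>)
  have R2: "gen (c, d) + gen (d, ?n c \<ominus>\<^bsub>ZN N\<^esub> d) + gen (?n c \<ominus>\<^bsub>ZN N\<^esub> d, c) \<in> ?H"
    if "(c, d) \<in> symbols N" for c d
    by (rule R) (use that in \<open>auto simp: modsym_rels_def\<close>)
  have R1': "gen (?n c, d) + gen (d, c) \<in> ?H" if "(c, d) \<in> symbols N" for c d
    using R1[OF sym(1)[OF that]] ZN_symbols(1)[OF N that] by simp
  from f consider c d where "(c, d) \<in> symbols N" "f = gen (c, d) + gen (d, ?n c)"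
    | c d where "(c, d) \<in> symbols N"
      "f = gen (c, d) + gen (d, ?n c \<ominus>\<^bsub>ZN N\<^esub> d) + gen (?n c \<ominus>\<^bsub>ZN N\<^esub> d, c)"
    by (auto simp: modsym_rels_def)
  then show ?thesis
  proof cases
    case 1
    have dc: "(d, c) \<in> symbols N" and c_d: "(c, ?n d) \<in> symbols N" using 1 by (meson sym)+
    have "(gen (?n c, d) + gen (d, c)) - (gen (d, c) + gen (c, ?n d))
        + (gen (c, ?n d) + gen (?n d, ?n c)) \<in> ?H"
      by (rule cl(1)[OF cl(2)[OF R1'[OF 1(1)] R1[OF dc]] R1[OF c_d]])
    also have "(gen (?n c, d) + gen (d, c)) - (gen (d, c) + gen (c, ?n d))
        + (gen (c, ?n d) + gen (?n d, ?n c))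
      = free_map (\<lambda>(c, d). (?n c, d)) (gen (c, d) + gen (d, ?n c))"
      by (simp add: free_map_add)
    finally show ?thesis unfolding 1(2) .
  next
    case 2
    let ?e = "?n c \<ominus>\<^bsub>ZN N\<^esub> d"
    have dc: "(d, c) \<in> symbols N" and de: "(d, ?e) \<in> symbols N" and ec: "(?e, c) \<in> symbols N"
      by (fact minus_in_symbols(2)[OF N 2(1)] ZN_symbols(3)[OF N 2(1)] ZN_symbols(4)[OF N 2(1)])+
    have R2': "gen (d, c) + gen (c, ?e) + gen (?e, d) \<in> ?H"
      using R2[OF dc] unfolding ZN_symbols(2)[OF N 2(1), symmetric] .
    have "(gen (?n c, d) + gen (d, c)) + (gen (?n d, ?e) + gen (?e, d)) + (gen (?n ?e, c) + gen (c, ?e))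
        - (gen (d, c) + gen (c, ?e) + gen (?e, d)) \<in> ?H"
      by (rule cl(2)[OF cl(1)[OF cl(1)[OF R1'[OF 2(1)] R1'[OF de]] R1'[OF ec]] R2'])
    also have "(gen (?n c, d) + gen (d, c)) + (gen (?n d, ?e) + gen (?e, d)) + (gen (?n ?e, c) + gen (c, ?e))
        - (gen (d, c) + gen (c, ?e) + gen (?e, d))
      = free_map (\<lambda>(c, d). (?n c, d)) (gen (c, d) + gen (d, ?e) + gen (?e, c))"
      by (simp add: free_map_add)
    finally show ?thesis unfolding 2(2) .
  qed
qed

lemma modsym_iota_coset:
  fixes N :: nat
  defines "F \<equiv> free_module (symbols N) :: (rat, int \<times> int \<Rightarrow>\<^sub>0 rat) module"
    and "H \<equiv> rel_span (symbols N) (modsym_rels N)"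
  assumes "N \<ge> 2" "f \<in> carrier F"
  shows "modsym_iota N (H +>\<^bsub>F\<^esub> f) = H +>\<^bsub>F\<^esub> free_map (\<lambda>(c, d). (\<ominus>\<^bsub>ZN N\<^esub> c, d)) f"
  unfolding modsym_iota_def F_def H_def
  by (rule quot_map_free_map_coset)
    (use assms iota_modsym_rels modsym_rels_carrier in \<open>auto simp: F_def minus_in_symbols(1)\<close>)

lemma tensor_rels_carrier:
  fixes M :: "(int, 'm) module"
  assumes "module ring_of_type_algebra M"
  shows "tensor_rels M \<subseteq> carrier (free_module (tensor_gens M))"
proof -
  interpret module "ring_of_type_algebra :: int ring" M by fact
  have [simp]: "n \<in> carrier ring_of_type_algebra" for n :: int
    by (simp add: ring_of_type_algebra_def)
  show ?thesis
    by (auto simp: tensor_rels_def tensor_gens_def intro!: free_module_closed gen_in_free_module)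
qed

lemma tensor_rat_smult_coset:
  fixes M :: "(int, 'm) module"
  defines "F \<equiv> free_module (tensor_gens M) :: (int, 'm \<times> rat \<Rightarrow>\<^sub>0 int) module"
    and "H \<equiv> rel_span (tensor_gens M) (tensor_rels M)"
  assumes M: "module ring_of_type_algebra M" and f: "f \<in> carrier F"
  shows "q \<odot>\<^bsub>tensor_rat M\<^esub> (H +>\<^bsub>F\<^esub> f) = H +>\<^bsub>F\<^esub> free_map (\<lambda>(x, r). (x, q * r)) f"
proof -
  have "free_map (\<lambda>(x, r). (x, q * r)) f \<in> tensor_rels M" if f: "f \<in> tensor_rels M" for f
  proof -
    from f consider x y r where "x \<in> carrier M" "y \<in> carrier M"
        "f = gen (x \<oplus>\<^bsub>M\<^esub> y, r) - gen (x, r) - gen (y, r)"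
      | x r s where "x \<in> carrier M" "f = gen (x, r + s) - gen (x, r) - gen (x, s)"
      | n x r where "x \<in> carrier M" "f = gen (n \<odot>\<^bsub>M\<^esub> x, r) - gen (x, of_int n * r)"
      unfolding tensor_rels_def by blast
    then show ?thesis
    proof cases
      case 1
      then show ?thesis unfolding tensor_rels_def
        by (intro UnI1 CollectI exI[of _ x] exI[of _ y] exI[of _ "q * r"]) (simp add: free_map_diff)
    next
      case 2
      then show ?thesis unfolding tensor_rels_def
        by (intro UnI1[OF UnI2] CollectI exI[of _ x] exI[of _ "q * r"] exI[of _ "q * s"])
          (simp add: free_map_diff distrib_left)
    next
      case 3
      then show ?thesis unfolding tensor_rels_def
        by (intro UnI2 CollectI exI[of _ x] exI[of _ n] exI[of _ "q * r"])
          (simp add: free_map_diff mult.left_commute)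
    qed
  qed
  then have "quot_map F H (free_map (\<lambda>(x, r). (x, q * r))) (H +>\<^bsub>F\<^esub> f)
      = H +>\<^bsub>F\<^esub> free_map (\<lambda>(x, r). (x, q * r)) f"
    unfolding F_def H_def
    by (intro quot_map_free_map_coset tensor_rels_carrier M)
      (use rels_in_rel_span[OF tensor_rels_carrier[OF M]] f in \<open>auto simp: tensor_gens_def F_def\<close>)
  then show ?thesis
    by (simp add: tensor_rat_def Let_def F_def H_def)
qed

lemma abelian_group_quot_module:
  fixes M :: "('r, 'm) module"
  assumes "abelian_subgroup H M"
  shows "abelian_group (quot_module M H)"
proof -
  interpret abelian_subgroup H M by fact
  show ?thesis
  proof (rule abelian_groupI)
    fix C D assume "C \<in> carrier (quot_module M H)" "D \<in> carrier (quot_module M H)"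
    then show "C \<oplus>\<^bsub>quot_module M H\<^esub> D = D \<oplus>\<^bsub>quot_module M H\<^esub> C"
      by (auto simp: quot_module_def A_RCOSETS_def' a_rcos_sum a_comm)
  next
    fix C assume "C \<in> carrier (quot_module M H)"
    then show "\<exists>D\<in>carrier (quot_module M H). D \<oplus>\<^bsub>quot_module M H\<^esub> C = \<zero>\<^bsub>quot_module M H\<^esub>"
      by (intro bexI[of _ "a_set_inv\<^bsub>M\<^esub> C"])
        (auto simp: quot_module_def a_rcosets_inv_mult_group_eq a_setinv_closed)
  qed (auto simp: quot_module_def a_setmult_closed a_rcosets_assoc a_subgroup_in_rcosets rcosets_add_eq)
qed

lemma module_presented_module:
  fixes rels :: "('x \<Rightarrow>\<^sub>0 'r :: comm_ring_1) set"
  assumes rels: "rels \<subseteq> carrier (free_module S)"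
  shows "module ring_of_type_algebra (presented_module S rels)"
proof -
  define R where "R = (ring_of_type_algebra :: 'r ring)"
  define F where "F = (free_module S :: ('r, 'x \<Rightarrow>\<^sub>0 'r) module)"
  define H where "H = rel_span S rels"
  interpret module R F unfolding R_def F_def by (rule module_free_module)
  interpret Hsub: abelian_subgroup H F unfolding H_def F_def by (rule abelian_subgroup_rel_span[OF rels])
  have sm: "submodule R H F"
    unfolding H_def rel_span_def F_def R_def
    by (rule span_is_submodule[unfolded R_def F_def, OF rels])
  have smult: "quot_map F H (\<lambda>x. r \<odot>\<^bsub>F\<^esub> x) (H +>\<^bsub>F\<^esub> f) = H +>\<^bsub>F\<^esub> (r \<odot>\<^bsub>F\<^esub> f)"
    if "r \<in> carrier R" "f \<in> carrier F" for r f
    using that submodule.smult_closed[OF sm]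
    by (intro quot_map_coset[OF Hsub.is_abelian_subgroup]) (auto simp: smult_r_distr)
  have "module R (quot_module F H)"
  proof (rule moduleI)
    show "abelian_group (quot_module F H)"
      by (rule abelian_group_quot_module) (rule Hsub.is_abelian_subgroup)
  qed (auto simp: R_def[symmetric] quot_module_def A_RCOSETS_def' smult Hsub.a_rcos_sum smult_l_distr smult_r_distr smult_assoc1
       intro: R.is_cring)
  then show ?thesis by (simp add: presented_module_def R_def F_def H_def)
qed

lemma M2_minus_rels_carrier:
  assumes "N \<ge> 2"
  shows "M2_minus_rels N \<subseteq> carrier (free_module (symbols N))"
  unfolding M2_minus_rels_def
  by (auto intro!: free_module_closed gen_in_free_module intro: minus_in_symbols(2)[OF assms]
      simp: minus_in_symbols(1,3,4)[OF assms])

lemma module_M2_minus: "N \<ge> 2 \<Longrightarrow> module ring_of_type_algebra (M2_minus N)"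
  unfolding M2_minus_def by (intro module_presented_module M2_minus_rels_carrier)

lemma module_modsym: "N \<ge> 2 \<Longrightarrow> module ring_of_type_algebra (modsym N)"
  unfolding modsym_def by (intro module_presented_module modsym_rels_carrier)

end

(*
In the minus part the involution acts by -1, so <-a,b> = -<a,b> becomes available; then the
relation (c,d) = -(d,-c) says exactly that symbols are symmetric, and the substitution a = c,
b = -d turns <a,b> = <a,b-a> + <a-b,b> into the three-term relation of modular symbols. Hence
M_2^-(Z/NZ) with rational coefficients is the space of coinvariants of modular symbols for -iota;
as 2 is invertible, f |-> f - iota f identifies it with the (-1)-eigenspace of iota.
*)
theory Submission
  imports Defs
begin

section \<open>Cosets in presented modules\<close>

text \<open>The coinvariants are never formed as a space. The sum of the symbols at (-a,b) and (a,b)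
  is not among the relations of modular symbols, so sending symbols to symbols would not respect the
  relations of M_2^-; composing with the antisymmetrisation repairs this. The resulting map and the
  map back are compared by their two composites: on the tensor product one gets the identity, on
  modular symbols the projector (1 - \<iota>)/2. The first composite yields injectivity, the second
  surjectivity onto the eigenspace, where the projector is the identity.

  The other obstacle is the choice of representatives. A generator of the tensor product pairs a
  rational with an element of M_2^-, which is itself a coset, so a map out of it has to pick a chain
  in each coset, and these picks are not additive. Every resulting error is an integral chain in the
  span of the relations of M_2^-, so the single lemma \<open>antisym_part_M2_minus_span\<close>
  absorbs all of them.\<close>

abbreviation scale :: "'r \<Rightarrow> ('x \<Rightarrow>\<^sub>0 'r) \<Rightarrow> ('x \<Rightarrow>\<^sub>0 'r :: comm_ring_1)" where
  "scale c \<equiv> Poly_Mapping.map ((*) c)"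

abbreviation coset :: "'x set \<Rightarrow> ('x \<Rightarrow>\<^sub>0 'r) set \<Rightarrow> ('x \<Rightarrow>\<^sub>0 'r :: comm_ring_1) \<Rightarrow> ('x \<Rightarrow>\<^sub>0 'r) set" where
  "coset S rels f \<equiv> rel_span S rels +>\<^bsub>free_module S\<^esub> f"

lemma scale_simps:
  "scale c (f + g) = scale c f + scale c g" "scale c (f - g) = scale c f - scale c g"
  "scale c (- f) = - scale c f" "scale c 0 = 0" "scale 0 f = 0" "scale 1 f = f"
  "scale c (scale d f) = scale (c * d) f" "scale c (Poly_Mapping.single x d) = Poly_Mapping.single x (c * d)"
  by (rule poly_mapping_eqI; simp add: lookup_scale lookup_add lookup_minus lookup_single when_def algebra_simps)+

lemma scale_add_left: "scale (c + d) f = scale c f + scale d f"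
  by (rule poly_mapping_eqI) (simp add: lookup_scale lookup_add algebra_simps)

lemma scale_sum: "scale c (sum f A) = (\<Sum>x\<in>A. scale c (f x))"
  by (rule poly_mapping_eqI) (simp add: lookup_scale lookup_sum sum_distrib_left)

lemma scale_minus_one: "scale (- 1) f = - f"
  by (rule poly_mapping_eqI) (simp add: lookup_scale)

lemma keys_scale: "Poly_Mapping.keys (scale c f) \<subseteq> Poly_Mapping.keys f"
  by (auto simp: in_keys_iff lookup_scale)

lemma carrier_free_module: "f \<in> carrier (free_module S) \<longleftrightarrow> Poly_Mapping.keys f \<subseteq> S"
  by (simp add: free_module_def)

lemma free_module_scale: "f \<in> carrier (free_module S) \<Longrightarrow> scale c f \<in> carrier (free_module S)"
  using keys_scale[of c f] by (auto simp: free_module_def)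

lemma free_module_zero: "0 \<in> carrier (free_module S)"
  by (simp add: free_module_def)

text \<open>One generator is stripped off the support at a time. The singles carry their
  coefficient, so no separate case for scaling is needed.\<close>

lemma free_module_induct [consumes 1, case_names zero single add]:
  assumes "f \<in> carrier (free_module S)"
    and "P 0" and "\<And>x c. x \<in> S \<Longrightarrow> P (Poly_Mapping.single x c)"
    and add: "\<And>f g. f \<in> carrier (free_module S) \<Longrightarrow> g \<in> carrier (free_module S) \<Longrightarrow> P f \<Longrightarrow> P g \<Longrightarrow> P (f + g)"
  shows "P f"
proof -
  have "P f" if "Poly_Mapping.keys f \<subseteq> S" for f
    using that
  proof (induction "card (Poly_Mapping.keys f)" arbitrary: f)
    case 0
    then show ?case using assms(2) by simp
  next
    case (Suc n)
    then obtain x where x: "x \<in> Poly_Mapping.keys f" by fastforce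
    let ?h = "Poly_Mapping.single x (Poly_Mapping.lookup f x)"
    have k: "Poly_Mapping.keys (f - ?h) = Poly_Mapping.keys f - {x}"
      by (auto simp: in_keys_iff lookup_minus lookup_single when_def split: if_splits)
    then have "P (f - ?h)" using Suc x by (intro Suc(1)) auto
    then have "P ((f - ?h) + ?h)" using assms(3)[of x] x Suc k
      by (intro add) (auto simp: carrier_free_module)
    then show ?case by simp
  qed
  then show ?thesis using assms(1) by (simp add: free_module_def)
qed

context
  fixes S :: "'x set" and rels :: "('x \<Rightarrow>\<^sub>0 'r :: comm_ring_1) set"
  assumes rels: "rels \<subseteq> carrier (free_module S)"
begin

lemma submodule_rel_span:
  "submodule (ring_of_type_algebra :: 'r ring) (rel_span S rels) (free_module S)"
proof -
  interpret module "ring_of_type_algebra :: 'r ring" "free_module S :: ('r, 'x \<Rightarrow>\<^sub>0 'r) module"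
    by (rule module_free_module)
  show ?thesis unfolding rel_span_def by (rule span_is_submodule[OF rels])
qed

lemma rel_span_carrier: "f \<in> rel_span S rels \<Longrightarrow> f \<in> carrier (free_module S)"
  using submodule.subset[OF submodule_rel_span] by blast

lemma rel_span_zero: "0 \<in> rel_span S rels"
  using submodule.zero_closed[OF submodule_rel_span] by (simp add: free_module_def)

lemma rel_span_uminus: "f \<in> rel_span S rels \<Longrightarrow> - f \<in> rel_span S rels"
  using rel_span_closed(2)[OF rels rel_span_zero, of f] by simp

lemma rel_span_scale: "f \<in> rel_span S rels \<Longrightarrow> scale c f \<in> rel_span S rels"
  using submodule.smult_closed[OF submodule_rel_span, of c f]
  by (simp add: free_module_def ring_of_type_algebra_def)

lemma rel_span_sum: "(\<And>i. i \<in> I \<Longrightarrow> f i \<in> rel_span S rels) \<Longrightarrow> sum f I \<in> rel_span S rels"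
  by (induction I rule: infinite_finite_induct) (auto intro: rel_span_zero rel_span_closed(1)[OF rels])

text \<open>The members of the span that satisfy \<open>P\<close> form a submodule containing the
  relations, and the span is the least such submodule.\<close>

lemma rel_span_induct [consumes 2, case_names zero rel add scale]:
  assumes f: "f \<in> rel_span S rels"
    and "P 0" and "\<And>f. f \<in> rels \<Longrightarrow> P f"
    and "\<And>f g. f \<in> rel_span S rels \<Longrightarrow> g \<in> rel_span S rels \<Longrightarrow> P f \<Longrightarrow> P g \<Longrightarrow> P (f + g)"
    and "\<And>c f. f \<in> rel_span S rels \<Longrightarrow> P f \<Longrightarrow> P (scale c f)"
  shows "P f"
proof -
  interpret module "ring_of_type_algebra :: 'r ring" "free_module S :: ('r, 'x \<Rightarrow>\<^sub>0 'r) module"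
    by (rule module_free_module)
  let ?K = "{f \<in> rel_span S rels. P f}"
  have "submodule (ring_of_type_algebra :: 'r ring) ?K (free_module S)"
  proof (unfold_locales, goal_cases)
    case 1 then show ?case using rel_span_carrier by auto
  next
    case (2 v w) then show ?case
      using assms(4)[of v w] rel_span_closed(1)[OF rels, of v w] by (simp add: free_module_def)
  next
    case 3 then show ?case using assms(2) rel_span_zero by (simp add: free_module_def)
  next
    case (4 c v) then show ?case
      using assms(5)[of v c] rel_span_scale[of v c] by (simp add: free_module_def)
  qed
  then have "span rels \<subseteq> ?K"
    by (rule span_is_subset[rotated]) (use assms(3) rels_in_rel_span[OF rels] in auto)
  then show ?thesis using f by (auto simp: rel_span_def)
qed

text \<open>Through this rule, equalities of classes become memberships in the span, which are then
  proved by adding and subtracting known relations.\<close>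

lemma coset_eq_iff: "coset S rels f = coset S rels g \<longleftrightarrow> f - g \<in> rel_span S rels"
proof
  have mem: "h \<in> coset S rels k \<longleftrightarrow> h - k \<in> rel_span S rels" for h k
    by (force simp: a_r_coset_def' free_module_def intro: bexI[of _ "h - k"])
  { assume "coset S rels f = coset S rels g"
    moreover have "f \<in> coset S rels f" by (simp add: mem rel_span_zero)
    ultimately show "f - g \<in> rel_span S rels" by (simp add: mem) }
  assume *: "f - g \<in> rel_span S rels"
  show "coset S rels f = coset S rels g"
  proof (rule Set.set_eqI)
    fix h show "h \<in> coset S rels f \<longleftrightarrow> h \<in> coset S rels g"
      using rel_span_closed(1)[OF rels _ *, of "h - f"] rel_span_closed(2)[OF rels _ *, of "h - g"]
      by (auto simp: mem)
  qed
qed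

lemma presented_module_carrier:
  "carrier (presented_module S rels) = coset S rels ` carrier (free_module S)"
  by (auto simp: presented_module_def quot_module_def A_RCOSETS_def')

lemma presented_module_add:
  assumes "f \<in> carrier (free_module S)" "g \<in> carrier (free_module S)"
  shows "coset S rels f \<oplus>\<^bsub>presented_module S rels\<^esub> coset S rels g = coset S rels (f + g)"
proof -
  interpret abelian_subgroup "rel_span S rels" "free_module S :: ('r, 'x \<Rightarrow>\<^sub>0 'r) module"
    by (rule abelian_subgroup_rel_span[OF rels])
  show ?thesis using a_rcos_sum[OF assms] 
    by (simp add: presented_module_def quot_module_def) (simp add: free_module_def)
qed

lemma presented_module_zero: "\<zero>\<^bsub>presented_module S rels\<^esub> = coset S rels 0"
  by (auto simp: presented_module_def quot_module_def a_r_coset_def' free_module_def)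

lemma presented_module_uminus:
  assumes "f \<in> carrier (free_module S)"
  shows "\<ominus>\<^bsub>presented_module S rels\<^esub> coset S rels f = coset S rels (- f)"
proof -
  interpret module "ring_of_type_algebra :: 'r ring" "presented_module S rels"
    by (rule module_presented_module[OF rels])
  show ?thesis
    by (rule minus_equality)
      (use assms in \<open>auto simp: presented_module_add presented_module_zero presented_module_carrier free_module_closed\<close>)
qed

lemma presented_module_smult:
  assumes "f \<in> carrier (free_module S)"
  shows "c \<odot>\<^bsub>presented_module S rels\<^esub> coset S rels f = coset S rels (scale c f)"
proof -
  have "quot_map (free_module S) (rel_span S rels) (scale c) (coset S rels f) = coset S rels (scale c f)"
    by (rule quot_map_coset[OF abelian_subgroup_rel_span[OF rels] assms])
      (auto simp: free_module_scale rel_span_scale, auto simp: free_module_def scale_simps)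
  then show ?thesis by (simp add: presented_module_def quot_module_def free_module_def)
qed

end

section \<open>Rational extensions as vector spaces\<close>

lemma coset_eqI:
  assumes "rels \<subseteq> carrier (free_module S)" "f - g \<in> rel_span S rels"
  shows "coset S rels f = coset S rels g"
  using coset_eq_iff[OF assms(1)] assms(2) by blast

lemma coset_eq_zero_iff:
  assumes "rels \<subseteq> carrier (free_module S)"
  shows "coset S rels f = coset S rels 0 \<longleftrightarrow> f \<in> rel_span S rels"
  using coset_eq_iff[OF assms, of f 0] by simp

lemma coset_add_cong:
  assumes "rels \<subseteq> carrier (free_module S)"
    and "coset S rels f = coset S rels f'" "coset S rels g = coset S rels g'"
  shows "coset S rels (f + g) = coset S rels (f' + g')" "coset S rels (f - g) = coset S rels (f' - g')"
  using rel_span_closed[OF assms(1), of "f - f'" "g - g'"] assms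
  by (auto simp: coset_eq_iff algebra_simps)

lemma coset_sum_cong:
  assumes "rels \<subseteq> carrier (free_module S)"
    and "\<And>i. i \<in> I \<Longrightarrow> coset S rels (f i) = coset S rels (g i)"
  shows "coset S rels (sum f I) = coset S rels (sum g I)"
  using assms rel_span_sum[OF assms(1), of I "\<lambda>i. f i - g i"]
  by (simp add: coset_eq_iff sum_subtractf)

lemma free_map_id: "free_map id f = f"
proof -
  have "f \<in> carrier (free_module UNIV)" by (simp add: carrier_free_module)
  then show ?thesis by (induction f rule: free_module_induct) (auto simp: free_map_add)
qed

abbreviation act_rat :: "rat \<Rightarrow> ('m \<times> rat \<Rightarrow>\<^sub>0 int) \<Rightarrow> ('m \<times> rat \<Rightarrow>\<^sub>0 int)" where
  "act_rat q \<equiv> free_map (\<lambda>(x, r). (x, q * r))"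

abbreviation tcoset :: "(int, 'm) module \<Rightarrow> ('m \<times> rat \<Rightarrow>\<^sub>0 int) \<Rightarrow> ('m \<times> rat \<Rightarrow>\<^sub>0 int) set" where
  "tcoset M \<equiv> coset (tensor_gens M) (tensor_rels M)"

section \<open>The tensor product with the rationals as a rational vector space\<close>

context
  fixes M :: "(int, 'm) module"
  assumes M: "module ring_of_type_algebra M"
begin

interpretation module "ring_of_type_algebra :: int ring" M by (rule M)

lemma act_rat_closed:
  "f \<in> carrier (free_module (tensor_gens M)) \<Longrightarrow> act_rat q f \<in> carrier (free_module (tensor_gens M))"
  unfolding carrier_free_module by (rule keys_free_map) (auto simp: tensor_gens_def)

lemmas tensor_cong = coset_add_cong[OF tensor_rels_carrier[OF M]]
lemmas tensor_coset_eq_iff = coset_eq_iff[OF tensor_rels_carrier[OF M]]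

lemma tcoset_add_left:
  assumes "x \<in> carrier M" "y \<in> carrier M"
  shows "tcoset M (gen (x \<oplus>\<^bsub>M\<^esub> y, q)) = tcoset M (gen (x, q) + gen (y, q))"
proof (rule coset_eqI[OF tensor_rels_carrier[OF M]])
  have "gen (x \<oplus>\<^bsub>M\<^esub> y, q) - gen (x, q) - gen (y, q) \<in> tensor_rels M"
    using assms by (auto simp: tensor_rels_def)
  then show "gen (x \<oplus>\<^bsub>M\<^esub> y, q) - (gen (x, q) + gen (y, q)) \<in> rel_span (tensor_gens M) (tensor_rels M)"
    using rels_in_rel_span[OF tensor_rels_carrier[OF M]] by (auto simp: algebra_simps)
qed

lemma tcoset_add_right:
  assumes "x \<in> carrier M"
  shows "tcoset M (gen (x, q + r)) = tcoset M (gen (x, q) + gen (x, r))"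
proof (rule coset_eqI[OF tensor_rels_carrier[OF M]])
  have "gen (x, q + r) - gen (x, q) - gen (x, r) \<in> tensor_rels M"
    using assms unfolding tensor_rels_def by blast
  then show "gen (x, q + r) - (gen (x, q) + gen (x, r)) \<in> rel_span (tensor_gens M) (tensor_rels M)"
    using rels_in_rel_span[OF tensor_rels_carrier[OF M]] by (auto simp: algebra_simps)
qed

lemma tcoset_smult:
  assumes "x \<in> carrier M"
  shows "tcoset M (gen (n \<odot>\<^bsub>M\<^esub> x, q)) = tcoset M (gen (x, of_int n * q))"
proof (rule coset_eqI[OF tensor_rels_carrier[OF M]])
  have "gen (n \<odot>\<^bsub>M\<^esub> x, q) - gen (x, of_int n * q) \<in> tensor_rels M"
    using assms unfolding tensor_rels_def by blast
  then show "gen (n \<odot>\<^bsub>M\<^esub> x, q) - gen (x, of_int n * q) \<in> rel_span (tensor_gens M) (tensor_rels M)"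
    using rels_in_rel_span[OF tensor_rels_carrier[OF M]] by blast
qed

text \<open>Additivity at 0 + 0 = 0 puts \<open>- gen (x, 0)\<close> into the span; its negative is
  what is wanted. The next lemma does the same in the other factor.\<close>

lemma tcoset_zero_right:
  assumes "x \<in> carrier M"
  shows "tcoset M (gen (x, 0)) = tcoset M 0"
  using tcoset_add_right[OF assms, of 0 0] rel_span_uminus[OF tensor_rels_carrier[OF M], of "- gen (x, 0)"]
  by (simp add: tensor_coset_eq_iff)

lemma tcoset_zero_left: "tcoset M (gen (\<zero>\<^bsub>M\<^esub>, q)) = tcoset M 0"
  using tcoset_add_left[of "\<zero>\<^bsub>M\<^esub>" "\<zero>\<^bsub>M\<^esub>" q]
    rel_span_uminus[OF tensor_rels_carrier[OF M], of "- gen (\<zero>\<^bsub>M\<^esub>, q)"]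
  by (simp add: tensor_coset_eq_iff)

text \<open>The scalar action lives on cosets, and \<open>tensor_rat_smult_coset\<close> computes it
  from any representative. Applied to the representatives \<open>f - g\<close> and 0 of the zero
  class, it gives the claim by linearity.\<close>

lemma act_rat_cong:
  assumes "tcoset M f = tcoset M g"
  shows "tcoset M (act_rat q f) = tcoset M (act_rat q g)"
proof -
  let ?H = "rel_span (tensor_gens M) (tensor_rels M)"
  have fg: "f - g \<in> ?H" using assms by (simp add: tensor_coset_eq_iff)
  have "tcoset M (act_rat q (f - g)) = q \<odot>\<^bsub>tensor_rat M\<^esub> tcoset M (f - g)"
    by (rule tensor_rat_smult_coset[OF M rel_span_carrier[OF tensor_rels_carrier[OF M] fg], symmetric])
  also have "tcoset M (f - g) = tcoset M 0"
    using fg by (simp add: coset_eq_zero_iff[OF tensor_rels_carrier[OF M]])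
  also have "q \<odot>\<^bsub>tensor_rat M\<^esub> tcoset M 0 = tcoset M (act_rat q 0)"
    by (rule tensor_rat_smult_coset[OF M free_module_zero])
  finally show ?thesis by (simp add: tensor_coset_eq_iff free_map_diff)
qed

text \<open>In the free module this fails: (x, (q + r) s) is one generator, while the right-hand
  side has two. Additivity in the rational factor identifies them modulo the relations.\<close>

lemma act_rat_add_left:
  assumes "f \<in> carrier (free_module (tensor_gens M))"
  shows "tcoset M (act_rat (q + r) f) = tcoset M (act_rat q f + act_rat r f)"
  using assms[unfolded carrier_free_module]
proof (induction f rule: frag_induction)
  case (one p)
  then show ?case
    using tcoset_add_right[of "fst p" "q * snd p" "r * snd p"]
    by (simp add: case_prod_beta tensor_gens_def distrib_right mem_Times_iff)
next
  case (diff f g)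
  then show ?case
    using tensor_cong(2)[OF diff] by (simp add: free_map_diff algebra_simps)
qed simp

lemma act_rat_mult: "act_rat (q * r) f = act_rat q (act_rat r f)"
proof -
  have "Poly_Mapping.keys f \<subseteq> UNIV" by simp
  then show ?thesis
    by (induction f rule: frag_induction) (auto simp: free_map_diff case_prod_beta mult.assoc)
qed

lemma tensor_rat_carrier: "carrier (tensor_rat M) = tcoset M ` carrier (free_module (tensor_gens M))"
  by (simp add: tensor_rat_def Let_def presented_module_carrier[OF tensor_rels_carrier[OF M]])

lemma tensor_rat_zero: "\<zero>\<^bsub>tensor_rat M\<^esub> = tcoset M 0"
  by (simp add: tensor_rat_def Let_def presented_module_zero[OF tensor_rels_carrier[OF M]])

lemma tensor_rat_add:
  "f \<in> carrier (free_module (tensor_gens M)) \<Longrightarrow> g \<in> carrier (free_module (tensor_gens M)) \<Longrightarrow>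
    tcoset M f \<oplus>\<^bsub>tensor_rat M\<^esub> tcoset M g = tcoset M (f + g)"
  by (simp add: tensor_rat_def Let_def presented_module_add[OF tensor_rels_carrier[OF M]])

lemma module_tensor_rat: "module (ring_of_type_algebra :: rat ring) (tensor_rat M)"
proof (rule moduleI)
  show "cring (ring_of_type_algebra :: rat ring)" by (rule cring_from_type_algebra)
  show "abelian_group (tensor_rat M)"
  proof (rule abelian_groupI)
    fix x assume "x \<in> carrier (tensor_rat M)"
    then obtain f where f: "f \<in> carrier (free_module (tensor_gens M))" "x = tcoset M f"
      by (auto simp: tensor_rat_carrier)
    then show "\<exists>y\<in>carrier (tensor_rat M). y \<oplus>\<^bsub>tensor_rat M\<^esub> x = \<zero>\<^bsub>tensor_rat M\<^esub>"
      by (intro bexI[of _ "tcoset M (- f)"])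
        (auto simp: tensor_rat_carrier tensor_rat_add tensor_rat_zero free_module_closed)
  qed (auto simp: tensor_rat_carrier tensor_rat_add tensor_rat_zero free_module_closed free_module_zero
         ac_simps)
qed (auto simp: tensor_rat_carrier tensor_rat_add tensor_rat_smult_coset[OF M] ring_of_type_algebra_def
       act_rat_closed act_rat_add_left act_rat_mult free_map_id free_map_add free_module_closed)

end

section \<open>Comparison of the relations\<close>

lemma free_map_sum: "free_map g (sum f I) = (\<Sum>i\<in>I. free_map g (f i))"
  by (induction I rule: infinite_finite_induct) (auto simp: free_map_add)

lemma finite_symbols: "finite (symbols N)"
  by (rule finite_subset[of _ "{0..int N - 1} \<times> {0..int N - 1}"])
    (auto simp: symbols_def residue_ring_def)

abbreviation iota :: "nat \<Rightarrow> (int \<times> int \<Rightarrow>\<^sub>0 'r) \<Rightarrow> (int \<times> int \<Rightarrow>\<^sub>0 'r :: comm_ring_1)" where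
  "iota N \<equiv> free_map (\<lambda>(c, d). (\<ominus>\<^bsub>ZN N\<^esub> c, d))"

text \<open>Twice the projector onto the (-1)-eigenspace of \<iota>. Without the factor 1/2 it also
  makes sense for integral chains.\<close>

definition antisym_part :: "nat \<Rightarrow> (int \<times> int \<Rightarrow>\<^sub>0 'r) \<Rightarrow> (int \<times> int \<Rightarrow>\<^sub>0 'r :: comm_ring_1)" where
  "antisym_part N f = f - iota N f"

abbreviation of_int_coeffs :: "('x \<Rightarrow>\<^sub>0 int) \<Rightarrow> ('x \<Rightarrow>\<^sub>0 rat)" where
  "of_int_coeffs \<equiv> Poly_Mapping.map of_int"

abbreviation mcoset :: "nat \<Rightarrow> (int \<times> int \<Rightarrow>\<^sub>0 int) \<Rightarrow> (int \<times> int \<Rightarrow>\<^sub>0 int) set" where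
  "mcoset N \<equiv> coset (symbols N) (M2_minus_rels N)"

lemma antisym_part_simps:
  "antisym_part N (f + g) = antisym_part N f + antisym_part N g"
  "antisym_part N (f - g) = antisym_part N f - antisym_part N g"
  "antisym_part N (- f) = - antisym_part N f"
  "antisym_part N 0 = 0"
  "antisym_part N (scale c f) = scale c (antisym_part N f)"
  by (simp_all add: antisym_part_def free_map_add free_map_diff free_map_uminus free_map_smult scale_simps)

lemma lookup_of_int_coeffs: "Poly_Mapping.lookup (of_int_coeffs f) x = of_int (Poly_Mapping.lookup f x)"
  by (simp add: Poly_Mapping.map.rep_eq when_def)

lemma of_int_coeffs_simps:
  "of_int_coeffs (f + g) = of_int_coeffs f + of_int_coeffs g"
  "of_int_coeffs (f - g) = of_int_coeffs f - of_int_coeffs g"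
  "of_int_coeffs (- f) = - of_int_coeffs f"
  "of_int_coeffs 0 = 0"
  "of_int_coeffs (scale c f) = scale (of_int c) (of_int_coeffs f)"
  "of_int_coeffs (Poly_Mapping.single x c) = Poly_Mapping.single x (of_int c)"
  by (rule poly_mapping_eqI;
      simp add: lookup_of_int_coeffs lookup_scale lookup_add lookup_minus lookup_single when_def)+

lemma keys_of_int_coeffs: "Poly_Mapping.keys (of_int_coeffs f) = Poly_Mapping.keys f"
  by (auto simp: in_keys_iff lookup_of_int_coeffs)

text \<open>Shows that the antisymmetrisation of an integral chain is again integral, as
  \<open>of_modsym_of_int_coeffs\<close> will require.\<close>

lemma antisym_part_of_int_coeffs: "antisym_part N (of_int_coeffs f) = of_int_coeffs (antisym_part N f)"
proof -
  have "Poly_Mapping.keys f \<subseteq> UNIV" by simp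
  then show ?thesis
    by (induction f rule: frag_induction)
      (auto simp: antisym_part_simps of_int_coeffs_simps, auto simp: antisym_part_def of_int_coeffs_simps)
qed

context
  fixes N :: nat
  assumes N: "N \<ge> 2"
begin

lemma iota_closed: "f \<in> carrier (free_module (symbols N)) \<Longrightarrow> iota N f \<in> carrier (free_module (symbols N))"
  unfolding carrier_free_module by (rule keys_free_map) (auto simp: minus_in_symbols(1)[OF N])

lemma iota_iota: "f \<in> carrier (free_module (symbols N)) \<Longrightarrow> iota N (iota N f) = f"
  by (induction f rule: free_module_induct) (auto simp: free_map_add ZN_symbols(1)[OF N])

lemma antisym_part_closed:
  "f \<in> carrier (free_module (symbols N)) \<Longrightarrow> antisym_part N f \<in> carrier (free_module (symbols N))"
  unfolding antisym_part_def by (intro free_module_closed iota_closed)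

lemma iota_antisym_part:
  "f \<in> carrier (free_module (symbols N)) \<Longrightarrow> iota N (antisym_part N f) = - antisym_part N f"
  by (simp add: antisym_part_def free_map_diff iota_iota)

lemma minus_minus_symbols:
  assumes "(a, b) \<in> symbols N"
  shows "\<ominus>\<^bsub>ZN N\<^esub> (\<ominus>\<^bsub>ZN N\<^esub> a) = a" "\<ominus>\<^bsub>ZN N\<^esub> (a \<ominus>\<^bsub>ZN N\<^esub> b) = b \<ominus>\<^bsub>ZN N\<^esub> a"
    "\<ominus>\<^bsub>ZN N\<^esub> a \<ominus>\<^bsub>ZN N\<^esub> (\<ominus>\<^bsub>ZN N\<^esub> b) = b \<ominus>\<^bsub>ZN N\<^esub> a" "a \<ominus>\<^bsub>ZN N\<^esub> (\<ominus>\<^bsub>ZN N\<^esub> b) = \<ominus>\<^bsub>ZN N\<^esub> (\<ominus>\<^bsub>ZN N\<^esub> a \<ominus>\<^bsub>ZN N\<^esub> b)"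
proof -
  interpret residues "int N" "ZN N" by unfold_locales (use N in auto)
  have "a \<in> carrier (ZN N)" "b \<in> carrier (ZN N)" using assms by (auto simp: symbols_def)
  then show "\<ominus>\<^bsub>ZN N\<^esub> (\<ominus>\<^bsub>ZN N\<^esub> a) = a" "\<ominus>\<^bsub>ZN N\<^esub> (a \<ominus>\<^bsub>ZN N\<^esub> b) = b \<ominus>\<^bsub>ZN N\<^esub> a"
    "\<ominus>\<^bsub>ZN N\<^esub> a \<ominus>\<^bsub>ZN N\<^esub> (\<ominus>\<^bsub>ZN N\<^esub> b) = b \<ominus>\<^bsub>ZN N\<^esub> a" "a \<ominus>\<^bsub>ZN N\<^esub> (\<ominus>\<^bsub>ZN N\<^esub> b) = \<ominus>\<^bsub>ZN N\<^esub> (\<ominus>\<^bsub>ZN N\<^esub> a \<ominus>\<^bsub>ZN N\<^esub> b)"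
    by (auto simp: a_minus_def minus_add a_comm)
qed

section \<open>The relations of the two presentations, carried into each other\<close>

lemma M2_minus_rel_span:
  fixes a b :: int
  defines "H \<equiv> rel_span (symbols N) (M2_minus_rels N)"
  assumes "(a, b) \<in> symbols N"
  shows "gen (a, b) - gen (b, a) \<in> H"
    and "gen (a, b) - (gen (a, b \<ominus>\<^bsub>ZN N\<^esub> a) + gen (a \<ominus>\<^bsub>ZN N\<^esub> b, b)) \<in> H"
    and "gen (\<ominus>\<^bsub>ZN N\<^esub> a, b) + gen (a, b) \<in> H"
proof -
  have R: "f \<in> H" if "f \<in> M2_minus_rels N" for f
    unfolding H_def using rels_in_rel_span[OF M2_minus_rels_carrier[OF N]] that by blast
  show "gen (a, b) - gen (b, a) \<in> H"
    "gen (a, b) - (gen (a, b \<ominus>\<^bsub>ZN N\<^esub> a) + gen (a \<ominus>\<^bsub>ZN N\<^esub> b, b)) \<in> H"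
    by (rule R; use assms in \<open>unfold M2_minus_rels_def, blast\<close>)+
  have "gen (\<ominus>\<^bsub>ZN N\<^esub> a, b) - (- gen (a, b)) \<in> H"
    by (rule R) (use assms in \<open>unfold M2_minus_rels_def, blast\<close>)
  then show "gen (\<ominus>\<^bsub>ZN N\<^esub> a, b) + gen (a, b) \<in> H" by simp
qed

text \<open>The third member is the first at (-c, d). It is the second description of the
  involution: \<iota> sends (c, d) to -(d, c).\<close>

lemma modsym_rel_span:
  fixes c d :: int
  defines "H \<equiv> rel_span (symbols N) (modsym_rels N)"
  assumes cd: "(c, d) \<in> symbols N"
  shows "gen (c, d) + gen (d, \<ominus>\<^bsub>ZN N\<^esub> c) \<in> H"
    and "gen (c, d) + gen (d, \<ominus>\<^bsub>ZN N\<^esub> c \<ominus>\<^bsub>ZN N\<^esub> d) + gen (\<ominus>\<^bsub>ZN N\<^esub> c \<ominus>\<^bsub>ZN N\<^esub> d, c) \<in> H"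
    and "gen (\<ominus>\<^bsub>ZN N\<^esub> c, d) + gen (d, c) \<in> H"
proof -
  have R: "f \<in> H" if "f \<in> modsym_rels N" for f
    unfolding H_def using rels_in_rel_span[OF modsym_rels_carrier[OF N]] that by blast
  have R1: "gen (c, d) + gen (d, \<ominus>\<^bsub>ZN N\<^esub> c) \<in> H" if "(c, d) \<in> symbols N" for c d
    by (rule R) (use that in \<open>force simp: modsym_rels_def\<close>)
  show "gen (c, d) + gen (d, \<ominus>\<^bsub>ZN N\<^esub> c) \<in> H" by (rule R1) (rule cd)
  show "gen (c, d) + gen (d, \<ominus>\<^bsub>ZN N\<^esub> c \<ominus>\<^bsub>ZN N\<^esub> d) + gen (\<ominus>\<^bsub>ZN N\<^esub> c \<ominus>\<^bsub>ZN N\<^esub> d, c) \<in> H"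
    by (rule R) (use cd in \<open>auto simp: modsym_rels_def\<close>)
  show "gen (\<ominus>\<^bsub>ZN N\<^esub> c, d) + gen (d, c) \<in> H"
    using R1[OF minus_in_symbols(1)[OF N cd]] by (simp add: minus_minus_symbols(1)[OF cd])
qed

text \<open>This direction needs no antisymmetrisation: the identity on symbols already carries the
  relations of modular symbols into those of M_2^-. It is what makes the map back well
  defined.\<close>

lemma modsym_rels_in_M2_minus_span:
  fixes c d :: int
  defines "H \<equiv> rel_span (symbols N) (M2_minus_rels N)"
  assumes cd: "(c, d) \<in> symbols N"
  shows "gen (c, d) + gen (d, \<ominus>\<^bsub>ZN N\<^esub> c) \<in> H"
    and "gen (c, d) + gen (d, \<ominus>\<^bsub>ZN N\<^esub> c \<ominus>\<^bsub>ZN N\<^esub> d) + gen (\<ominus>\<^bsub>ZN N\<^esub> c \<ominus>\<^bsub>ZN N\<^esub> d, c) \<in> H"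
proof -
  define e where "e = \<ominus>\<^bsub>ZN N\<^esub> c \<ominus>\<^bsub>ZN N\<^esub> d"
  let ?n = "\<lambda>x. \<ominus>\<^bsub>ZN N\<^esub> x"
  note cl = rel_span_closed[OF M2_minus_rels_carrier[OF N], folded H_def]
  note Z = M2_minus_rel_span[folded H_def]
  note sym = minus_in_symbols[OF N]
  have dc: "(d, c) \<in> symbols N" and c_d: "(c, ?n d) \<in> symbols N" using cd by (meson sym)+
  have de: "(d, e) \<in> symbols N" and ec: "(e, c) \<in> symbols N"
    unfolding e_def by (fact ZN_symbols(3,4)[OF N cd])+
  have ed: "(e, d) \<in> symbols N" and ce: "(c, e) \<in> symbols N" using de ec by (meson sym)+
  have e_d: "(e, ?n d) \<in> symbols N" using ed by (meson sym)
  \<comment> \<open>A sign in the second argument: swap, apply the sign relation in the first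
    argument, swap back.\<close>
  have Z4: "gen (a, ?n b) + gen (a, b) \<in> H" if ab: "(a, b) \<in> symbols N" for a b
  proof -
    have ba: "(b, a) \<in> symbols N" and a_b: "(a, ?n b) \<in> symbols N" using ab by (meson sym)+
    show ?thesis using cl(1)[OF cl(1)[OF Z(1)[OF a_b] Z(3)[OF ba]] Z(1)[OF ab]]
      by (simp add: algebra_simps)
  qed
  have "(gen (?n c, d) + gen (c, d)) - (gen (?n c, d) - gen (d, ?n c)) \<in> H"
    by (rule cl(2)[OF Z(3)[OF cd] Z(1)[OF sym(1)[OF cd]]])
  then show "gen (c, d) + gen (d, ?n c) \<in> H" by (simp add: algebra_simps)
  \<comment> \<open>The relation for <a,b> at a = c, b = -d; its differences are b - a = e and a - b
    = -e.\<close>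
  have "gen (c, ?n d) - (gen (c, e) + gen (?n e, ?n d)) \<in> H"
    using Z(2)[OF c_d] unfolding minus_minus_symbols(4)[OF cd] ZN_symbols(2)[OF N cd, symmetric]
    unfolding e_def .
  \<comment> \<open>In the previous relation <c,-d> is -<c,d>, <c,e> is <e,c>, and <-e,-d> is
    -<e,-d> = <e,d> = <d,e>; the chain performs these replacements in this order.\<close>
  note cl(2)[OF cl(1)[OF cl(2)[OF cl(2)[OF cl(2)[OF Z4[OF cd] this] Z(1)[OF ce]] Z(3)[OF e_d]] Z4[OF ed]] Z(1)[OF ed]]
  then show "gen (c, d) + gen (d, ?n c \<ominus>\<^bsub>ZN N\<^esub> d) + gen (?n c \<ominus>\<^bsub>ZN N\<^esub> d, c) \<in> H"
    unfolding e_def[symmetric] by (simp add: algebra_simps)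
qed

text \<open>Here the antisymmetrisation is essential. Since \<iota> is (c, d) to -(d, c) modulo the
  relations, f - \<iota> f symmetrises the two arguments, which disposes of the symmetry relation;
  the sign relation and the three-term relation are treated below.\<close>

lemma antisym_part_M2_minus_rels:
  assumes "f \<in> M2_minus_rels N"
  shows "antisym_part N (of_int_coeffs f) \<in> rel_span (symbols N) (modsym_rels N)"
    (is "_ \<in> ?H")
proof -
  let ?n = "\<lambda>x. \<ominus>\<^bsub>ZN N\<^esub> x"
  note cl = rel_span_closed[OF modsym_rels_carrier[OF N]]
  note R = modsym_rel_span
  note sym = minus_in_symbols[OF N]
  from assms consider
      a b where "(a, b) \<in> symbols N" "f = gen (a, b) - gen (b, a)"
    | a b where "(a, b) \<in> symbols N"
        "f = gen (a, b) - (gen (a, b \<ominus>\<^bsub>ZN N\<^esub> a) + gen (a \<ominus>\<^bsub>ZN N\<^esub> b, b))"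
    | a b where "(a, b) \<in> symbols N" "f = gen (?n a, b) - (- gen (a, b))"
    unfolding M2_minus_rels_def by blast
  then show ?thesis
  proof cases
    case 1
    have ba: "(b, a) \<in> symbols N" using 1 by (meson sym)
    show ?thesis using cl(2)[OF R(3)[OF ba] R(3)[OF 1(1)]]
      by (simp add: 1(2) antisym_part_def of_int_coeffs_simps free_map_diff algebra_simps)
  next
    case 2
    define e where "e = b \<ominus>\<^bsub>ZN N\<^esub> a"
    have ab: "(a, b) \<in> symbols N" by (fact 2(1))
    have ba: "(b, a) \<in> symbols N" and a_b: "(a, ?n b) \<in> symbols N" and nba: "(?n b, a) \<in> symbols N"
      and ae: "(a, e) \<in> symbols N"
      using ab unfolding e_def by (meson sym)+
    have eb: "(e, b) \<in> symbols N"
      using sym(1)[OF sym(4)[OF ab]] by (simp add: e_def minus_minus_symbols(2)[OF ab])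
    then have be: "(b, e) \<in> symbols N" by (rule sym(2))
    have e: "?n e = a \<ominus>\<^bsub>ZN N\<^esub> b" "?n (a \<ominus>\<^bsub>ZN N\<^esub> b) = e" "?n a \<ominus>\<^bsub>ZN N\<^esub> (?n b) = e"
      "?n (?n b) \<ominus>\<^bsub>ZN N\<^esub> a = e"
      unfolding e_def by (simp_all add: minus_minus_symbols[OF ab] minus_minus_symbols[OF ba])
    \<comment> \<open>The three-term relations at (a,-b) and (-b,a) both have third entry e. Up to a
      cyclic shift, the second is the image of the first under (c, d) to (d, c), that is, under
      -\<iota>. Their sum thus represents the antisymmetrised relation, and two-term relations bring
      its six symbols into the required form.\<close>
    have "gen (a, ?n b) + gen (?n b, e) + gen (e, a) \<in> ?H" "gen (?n b, a) + gen (a, e) + gen (e, ?n b) \<in> ?H"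
      using R(2)[OF a_b] R(2)[OF nba] unfolding e .
    note cl(2)[OF cl(1)[OF cl(1)[OF cl(1)[OF cl(1)[OF R(3)[OF ae] R(1)[OF ba]] R(3)[OF ba]] R(1)[OF be]] R(3)[OF be]]
      cl(1)[OF cl(1)[OF cl(1)[OF this] R(3)[OF ab]] R(3)[OF eb]]]
    then show ?thesis unfolding 2(2)
      by (simp add: antisym_part_def of_int_coeffs_simps free_map_diff free_map_add e e_def[symmetric] algebra_simps)
  next
    case 3
    \<comment> \<open>\<iota> exchanges the two terms of the sign relation, so their sum is
      \<iota>-invariant and its antisymmetrisation is exactly 0.\<close>
    then show ?thesis
      by (simp add: antisym_part_def of_int_coeffs_simps free_map_add minus_minus_symbols
          rel_span_zero[OF modsym_rels_carrier[OF N]])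
  qed
qed

lemma antisym_part_M2_minus_span:
  assumes "f \<in> rel_span (symbols N) (M2_minus_rels N)"
  shows "antisym_part N (of_int_coeffs f) \<in> rel_span (symbols N) (modsym_rels N)"
  using M2_minus_rels_carrier[OF N] assms
  by (induction f rule: rel_span_induct)
    (auto simp: of_int_coeffs_simps antisym_part_simps antisym_part_M2_minus_rels
      intro!: rel_span_zero rel_span_closed rel_span_scale modsym_rels_carrier N)

end

section \<open>The isomorphism\<close>

text \<open>
  The next two maps of free modules induce, up to the choice of representatives, the isomorphism and
  its inverse: \<open>x \<otimes> q\<close> goes to \<open>q (r - \<iota> r)\<close> for a representative \<open>r\<close> of \<open>x\<close>, and the class of a
  symbol \<open>s\<close> goes back to \<open>s \<otimes> (1/2)\<close>, because \<open>r - \<iota> r\<close> and \<open>2 r\<close> have the same class in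
  \<^term>\<open>M2_minus N\<close>. The sum over all symbols makes the map back respect scalars exactly, but it is
  additive only modulo the tensor relations.
\<close>

definition symbol_rep :: "nat \<Rightarrow> (int \<times> int \<Rightarrow>\<^sub>0 int) set \<Rightarrow> (int \<times> int \<Rightarrow>\<^sub>0 int)" where
  "symbol_rep N x = (SOME r. r \<in> carrier (free_module (symbols N)) \<and> mcoset N r = x)"

definition to_modsym ::
  "nat \<Rightarrow> ((int \<times> int \<Rightarrow>\<^sub>0 int) set \<times> rat \<Rightarrow>\<^sub>0 int) \<Rightarrow> (int \<times> int \<Rightarrow>\<^sub>0 rat)" where
  "to_modsym N f =
     (\<Sum>(x, q)\<in>Poly_Mapping.keys f.
        scale (of_int (Poly_Mapping.lookup f (x, q)) * q) (antisym_part N (of_int_coeffs (symbol_rep N x))))"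

definition of_modsym ::
  "nat \<Rightarrow> (int \<times> int \<Rightarrow>\<^sub>0 rat) \<Rightarrow> ((int \<times> int \<Rightarrow>\<^sub>0 int) set \<times> rat \<Rightarrow>\<^sub>0 int)" where
  "of_modsym N g = (\<Sum>s\<in>symbols N. gen (mcoset N (gen s), Poly_Mapping.lookup g s / 2))"

lemma to_modsym_superset:
  assumes "finite A" "Poly_Mapping.keys f \<subseteq> A"
  shows "to_modsym N f = (\<Sum>p\<in>A. scale (of_int (Poly_Mapping.lookup f p) * snd p)
    (antisym_part N (of_int_coeffs (symbol_rep N (fst p)))))"
  unfolding to_modsym_def case_prod_beta
  by (intro sum.mono_neutral_cong_left) (use assms in \<open>auto simp: in_keys_iff scale_simps\<close>)

lemma to_modsym_diff: "to_modsym N (f - g) = to_modsym N f - to_modsym N g"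
proof -
  let ?A = "Poly_Mapping.keys f \<union> Poly_Mapping.keys g"
  have "scale ((of_int a - of_int b) * q) h = scale (of_int a * q) h - scale (of_int b * q) h"
    for a b q and h :: "int \<times> int \<Rightarrow>\<^sub>0 rat"
    using scale_add_left[of "of_int a * q" "- (of_int b * q)" h]
      scale_simps(7)[of "- 1" "of_int b * q" h, symmetric]
    by (simp add: scale_minus_one left_diff_distrib)
  then show ?thesis
    using keys_diff[of f g]
    by (simp add: to_modsym_superset[of ?A] lookup_minus sum_subtractf)
qed

lemma to_modsym_zero: "to_modsym N 0 = 0"
  by (simp add: to_modsym_def)

lemma to_modsym_add: "to_modsym N (f + g) = to_modsym N f + to_modsym N g"
  using to_modsym_diff[of N f "- g"] to_modsym_diff[of N 0 g] by (simp add: to_modsym_zero)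

lemma to_modsym_gen:
  "to_modsym N (gen (x, q)) = scale q (antisym_part N (of_int_coeffs (symbol_rep N x)))"
  by (simp add: to_modsym_superset[of "{(x, q)}"])

lemma to_modsym_sum: "to_modsym N (sum f I) = (\<Sum>i\<in>I. to_modsym N (f i))"
  by (induction I rule: infinite_finite_induct) (auto simp: to_modsym_add to_modsym_zero)

lemma to_modsym_act_rat: "to_modsym N (act_rat q f) = scale q (to_modsym N f)"
proof -
  have "Poly_Mapping.keys f \<subseteq> UNIV" by simp
  then show ?thesis
    by (induction f rule: frag_induction)
      (auto simp: to_modsym_diff to_modsym_zero to_modsym_gen free_map_diff scale_simps)
qed

lemma to_modsym_scale: "to_modsym N (scale c f) = scale (of_int c) (to_modsym N f)"
  using keys_scale[of c f]
  by (simp add: to_modsym_superset[of "Poly_Mapping.keys f"] lookup_scale scale_sum scale_simps mult.assoc)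

lemma of_modsym_scale: "of_modsym N (scale q g) = act_rat q (of_modsym N g)"
  by (simp add: of_modsym_def free_map_sum lookup_scale)

context
  fixes N :: nat
  assumes N: "N \<ge> 2"
begin

interpretation M2: module "ring_of_type_algebra :: int ring" "M2_minus N"
  by (rule module_M2_minus[OF N])

section \<open>The integral module in terms of representatives\<close>

lemma M2_minus_carrier: "carrier (M2_minus N) = mcoset N ` carrier (free_module (symbols N))"
  unfolding M2_minus_def by (rule presented_module_carrier[OF M2_minus_rels_carrier[OF N]])

lemma M2_minus_add:
  "f \<in> carrier (free_module (symbols N)) \<Longrightarrow> g \<in> carrier (free_module (symbols N)) \<Longrightarrow>
    mcoset N f \<oplus>\<^bsub>M2_minus N\<^esub> mcoset N g = mcoset N (f + g)"
  unfolding M2_minus_def by (rule presented_module_add[OF M2_minus_rels_carrier[OF N]])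

lemma M2_minus_smult:
  "f \<in> carrier (free_module (symbols N)) \<Longrightarrow> c \<odot>\<^bsub>M2_minus N\<^esub> mcoset N f = mcoset N (scale c f)"
  unfolding M2_minus_def by (rule presented_module_smult[OF M2_minus_rels_carrier[OF N]])

lemma M2_minus_zero: "\<zero>\<^bsub>M2_minus N\<^esub> = mcoset N 0"
  unfolding M2_minus_def by (rule presented_module_zero[OF M2_minus_rels_carrier[OF N]])

lemma mcoset_closed: "f \<in> carrier (free_module (symbols N)) \<Longrightarrow> mcoset N f \<in> carrier (M2_minus N)"
  by (simp add: M2_minus_carrier)

lemma symbol_rep:
  assumes "x \<in> carrier (M2_minus N)"
  shows "symbol_rep N x \<in> carrier (free_module (symbols N))" "mcoset N (symbol_rep N x) = x"
proof -
  from assms have "\<exists>r. r \<in> carrier (free_module (symbols N)) \<and> mcoset N r = x"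
    by (auto simp: M2_minus_carrier)
  from someI_ex[OF this] show "symbol_rep N x \<in> carrier (free_module (symbols N))"
    "mcoset N (symbol_rep N x) = x"
    by (simp_all add: symbol_rep_def)
qed

lemma of_modsym_closed: "of_modsym N g \<in> carrier (free_module (tensor_gens (M2_minus N)))"
  unfolding carrier_free_module of_modsym_def
  by (rule order.trans[OF Poly_Mapping.keys_sum])
    (auto simp: tensor_gens_def intro!: mcoset_closed gen_in_free_module)

abbreviation "tcs \<equiv> tcoset (M2_minus N)"

lemmas tens_cong = tensor_cong[OF module_M2_minus[OF N]]
lemmas tens_rels = tensor_rels_carrier[OF module_M2_minus[OF N]]

section \<open>The map from modular symbols back to the tensor product\<close>

lemma of_modsym_add: "tcs (of_modsym N (f + g)) = tcs (of_modsym N f + of_modsym N g)"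
proof -
  have "tcs (of_modsym N (f + g)) = tcs (\<Sum>s\<in>symbols N.
      gen (mcoset N (gen s), Poly_Mapping.lookup f s / 2) + gen (mcoset N (gen s), Poly_Mapping.lookup g s / 2))"
    unfolding of_modsym_def
    by (rule coset_sum_cong[OF tens_rels])
      (simp add: lookup_add add_divide_distrib tcoset_add_right[OF module_M2_minus[OF N]]
        mcoset_closed gen_in_free_module)
  then show ?thesis by (simp add: of_modsym_def sum.distrib)
qed

lemma of_modsym_diff: "tcs (of_modsym N (f - g)) = tcs (of_modsym N f - of_modsym N g)"
  using tens_cong(2)[OF of_modsym_add[of "f - g" g] refl, of "of_modsym N g"] by simp

text \<open>The other summands are generators (x, 0), nonzero in the free module but zero modulo the
  tensor relations.\<close>

lemma of_modsym_single:
  assumes "s \<in> symbols N"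
  shows "tcs (of_modsym N (Poly_Mapping.single s q)) = tcs (gen (mcoset N (gen s), q / 2))"
proof -
  have "tcs (of_modsym N (Poly_Mapping.single s q))
      = tcs (\<Sum>t\<in>symbols N. if t = s then gen (mcoset N (gen s), q / 2) else 0)"
    unfolding of_modsym_def
    by (rule coset_sum_cong[OF tens_rels])
      (auto simp: lookup_single when_def tcoset_zero_right[OF module_M2_minus[OF N]]
        mcoset_closed gen_in_free_module)
  then show ?thesis using assms by (simp add: finite_symbols)
qed

text \<open>For an integral chain the coefficients can be moved across the tensor sign, so the sum
  over all symbols collapses to one pure tensor. This serves both to kill relations and to compute a
  composite.\<close>

lemma of_modsym_of_int_coeffs:
  assumes "r \<in> carrier (free_module (symbols N))"
  shows "tcs (of_modsym N (scale q (of_int_coeffs r))) = tcs (gen (mcoset N r, q / 2))"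
  using assms
proof (induction r rule: free_module_induct)
  case zero
  have "tcs (of_modsym N 0) = tcs 0" using of_modsym_diff[of 0 0] by simp
  then show ?case
    using tcoset_zero_left[OF module_M2_minus[OF N], of "q / 2"]
    by (simp add: of_int_coeffs_simps scale_simps M2_minus_zero)
next
  case (single s c)
  have g: "gen s \<in> carrier (free_module (symbols N))" using single by (rule gen_in_free_module)
  have "mcoset N (Poly_Mapping.single s c) = c \<odot>\<^bsub>M2_minus N\<^esub> mcoset N (gen s)"
    by (simp add: M2_minus_smult[OF g] scale_simps)
  then show ?case
    using single tcoset_smult[OF module_M2_minus[OF N] mcoset_closed[OF g], of c "q / 2"]
    by (simp add: of_int_coeffs_simps scale_simps of_modsym_single mult.commute)
next
  case (add f g)
  have "tcs (of_modsym N (scale q (of_int_coeffs (f + g))))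
      = tcs (of_modsym N (scale q (of_int_coeffs f)) + of_modsym N (scale q (of_int_coeffs g)))"
    by (simp add: of_int_coeffs_simps scale_simps of_modsym_add)
  also have "\<dots> = tcs (gen (mcoset N f, q / 2) + gen (mcoset N g, q / 2))"
    by (rule tens_cong(1)) (use add in auto)
  also have "\<dots> = tcs (gen (mcoset N f \<oplus>\<^bsub>M2_minus N\<^esub> mcoset N g, q / 2))"
    by (rule tcoset_add_left[OF module_M2_minus[OF N], symmetric]) (use add in \<open>auto intro: mcoset_closed\<close>)
  finally show ?case using add by (simp add: M2_minus_add)
qed

text \<open>The defining relations of modular symbols have integer coefficients, so each is an
  integral chain r whose class in \<open>M2_minus N\<close> vanishes; its image is therefore 0
  \<otimes> (1/2).\<close>

lemma of_modsym_modsym_span: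
  assumes "f \<in> rel_span (symbols N) (modsym_rels N)"
  shows "tcs (of_modsym N f) = tcs 0"
  using modsym_rels_carrier[OF N] assms
proof (induction f rule: rel_span_induct)
  case zero
  show ?case using of_modsym_diff[of 0 0] by simp
next
  case (rel f)
  then consider c d where "(c, d) \<in> symbols N" "f = of_int_coeffs (gen (c, d) + gen (d, \<ominus>\<^bsub>ZN N\<^esub> c))"
    | c d where "(c, d) \<in> symbols N"
      "f = of_int_coeffs (gen (c, d) + gen (d, \<ominus>\<^bsub>ZN N\<^esub> c \<ominus>\<^bsub>ZN N\<^esub> d) + gen (\<ominus>\<^bsub>ZN N\<^esub> c \<ominus>\<^bsub>ZN N\<^esub> d, c))"
    by (auto simp: modsym_rels_def of_int_coeffs_simps)
  then obtain r where r: "f = of_int_coeffs r" "r \<in> rel_span (symbols N) (M2_minus_rels N)"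
    by (metis modsym_rels_in_M2_minus_span[OF N])
  have "mcoset N r = \<zero>\<^bsub>M2_minus N\<^esub>"
    unfolding M2_minus_zero using r(2) by (simp add: coset_eq_zero_iff[OF M2_minus_rels_carrier[OF N]])
  then show ?case
    using of_modsym_of_int_coeffs[OF rel_span_carrier[OF M2_minus_rels_carrier[OF N] r(2)], of 1]
      tcoset_zero_left[OF module_M2_minus[OF N]] by (simp add: r(1) scale_simps)
next
  case (add f g)
  then show ?case using tens_cong(1)[OF add(3,4)] by (simp add: of_modsym_add)
next
  case (scale c f)
  then show ?case using act_rat_cong[OF module_M2_minus[OF N] scale(2), of c] by (simp add: of_modsym_scale)
qed

text \<open>The sign relation, extended linearly, says that r + \<iota> r is zero in M_2^-, and r -
  \<iota> r differs from 2 r by exactly this chain.\<close>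

lemma mcoset_antisym_part:
  assumes "r \<in> carrier (free_module (symbols N))"
  shows "mcoset N (antisym_part N r) = 2 \<odot>\<^bsub>M2_minus N\<^esub> mcoset N r"
proof -
  note cl = rel_span_closed(1)[OF M2_minus_rels_carrier[OF N]]
  have "r + iota N r \<in> rel_span (symbols N) (M2_minus_rels N)"
    using assms
  proof (induction r rule: free_module_induct)
    case zero
    show ?case by (simp add: rel_span_zero[OF M2_minus_rels_carrier[OF N]])
  next
    case (single s c)
    obtain a b where s: "s = (a, b)" by force
    show ?case
      using rel_span_scale[OF M2_minus_rels_carrier[OF N] M2_minus_rel_span(3)[OF N single[unfolded s]], of c]
      by (simp add: s scale_simps add.commute)
  next
    case (add f g)
    then show ?case using cl[OF add(3,4)] by (simp add: free_map_add algebra_simps)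
  qed
  then have "- (r + iota N r) \<in> rel_span (symbols N) (M2_minus_rels N)"
    by (rule rel_span_uminus[OF M2_minus_rels_carrier[OF N]])
  moreover have "antisym_part N r - scale 2 r = - (r + iota N r)"
    using scale_add_left[of 1 1 r] by (simp add: antisym_part_def scale_simps)
  ultimately show ?thesis
    by (simp add: M2_minus_smult[OF assms] coset_eq_iff[OF M2_minus_rels_carrier[OF N]])
qed

text \<open>Additivity in the rational factor holds exactly. In the other two relations the chosen
  representatives are compatible only up to an integral chain of class zero, and the
  antisymmetrisation sends such a chain into the span of the modular symbol relations.\<close>

lemma to_modsym_tensor_span:
  assumes "f \<in> rel_span (tensor_gens (M2_minus N)) (tensor_rels (M2_minus N))"
  shows "to_modsym N f \<in> rel_span (symbols N) (modsym_rels N)"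
  using tens_rels assms
proof (induction f rule: rel_span_induct)
  case (rel f)
  let ?A = "\<lambda>r. antisym_part N (of_int_coeffs r)" and ?\<rho> = "symbol_rep N"
  have A: "?A r \<in> rel_span (symbols N) (modsym_rels N)" if "mcoset N r = mcoset N 0" for r
    using that by (intro antisym_part_M2_minus_span[OF N])
      (simp add: coset_eq_zero_iff[OF M2_minus_rels_carrier[OF N]])
  from rel consider x y q where "x \<in> carrier (M2_minus N)" "y \<in> carrier (M2_minus N)"
        "f = gen (x \<oplus>\<^bsub>M2_minus N\<^esub> y, q) - gen (x, q) - gen (y, q)"
    | x q r where "x \<in> carrier (M2_minus N)" "f = gen (x, q + r) - gen (x, q) - gen (x, r)"
    | n x q where "x \<in> carrier (M2_minus N)" "f = gen (n \<odot>\<^bsub>M2_minus N\<^esub> x, q) - gen (x, of_int n * q)"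
    unfolding tensor_rels_def by blast
  then show ?case
  proof cases
    case 1
    note xy = symbol_rep[OF 1(1)] symbol_rep[OF 1(2)]
    have "mcoset N (?\<rho> (x \<oplus>\<^bsub>M2_minus N\<^esub> y)) = mcoset N (?\<rho> x + ?\<rho> y)"
      using symbol_rep(2)[OF M2.add.m_closed[OF 1(1,2)]] M2_minus_add[OF xy(1,3)] xy by simp
    then have "mcoset N (?\<rho> (x \<oplus>\<^bsub>M2_minus N\<^esub> y) - ?\<rho> x - ?\<rho> y) = mcoset N 0"
      by (simp add: coset_eq_iff[OF M2_minus_rels_carrier[OF N]] diff_diff_eq)
    from rel_span_scale[OF modsym_rels_carrier[OF N] A[OF this], of q] show ?thesis
      by (simp add: 1(3) to_modsym_diff to_modsym_gen of_int_coeffs_simps antisym_part_simps scale_simps)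
  next
    case 2
    then show ?thesis
      by (simp add: to_modsym_diff to_modsym_gen scale_add_left rel_span_zero[OF modsym_rels_carrier[OF N]])
  next
    case 3
    note x = symbol_rep[OF 3(1)]
    have "n \<odot>\<^bsub>M2_minus N\<^esub> x \<in> carrier (M2_minus N)"
      using 3(1) by (simp add: M2.smult_closed ring_of_type_algebra_def)
    then have "mcoset N (?\<rho> (n \<odot>\<^bsub>M2_minus N\<^esub> x)) = mcoset N (scale n (?\<rho> x))"
      using symbol_rep(2) M2_minus_smult[OF x(1), of n] x(2) by simp
    then have "mcoset N (?\<rho> (n \<odot>\<^bsub>M2_minus N\<^esub> x) - scale n (?\<rho> x)) = mcoset N 0"
      by (simp add: coset_eq_iff[OF M2_minus_rels_carrier[OF N]])
    from rel_span_scale[OF modsym_rels_carrier[OF N] A[OF this], of q] show ?thesis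
      by (simp add: 3(2) to_modsym_diff to_modsym_gen of_int_coeffs_simps antisym_part_simps scale_simps
          mult.commute)
  qed
qed (auto simp: to_modsym_zero to_modsym_add to_modsym_scale
      intro!: rel_span_zero rel_span_closed rel_span_scale modsym_rels_carrier N)

text \<open>The eigenvector equation holds already in the free module, because \<iota> is an exact
  involution on symbols.\<close>

lemma to_modsym_closed_iota:
  assumes "f \<in> carrier (free_module (tensor_gens (M2_minus N)))"
  shows "to_modsym N f \<in> carrier (free_module (symbols N)) \<and> iota N (to_modsym N f) = - to_modsym N f"
  using assms[unfolded carrier_free_module]
proof (induction f rule: frag_induction)
  case zero
  show ?case by (simp add: to_modsym_zero free_module_zero)
next
  case (one p)
  then have "of_int_coeffs (symbol_rep N (fst p)) \<in> carrier (free_module (symbols N))"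
    using symbol_rep(1)[of "fst p"] by (auto simp: tensor_gens_def carrier_free_module keys_of_int_coeffs)
  then show ?case
    using to_modsym_gen[of N "fst p" "snd p"]
    by (simp add: free_map_smult iota_antisym_part[OF N] antisym_part_closed[OF N] free_module_scale scale_simps)
next
  case (diff f g)
  then show ?case by (simp add: to_modsym_diff free_map_diff free_module_closed)
qed

text \<open>On a generator, x \<otimes> q goes to q (r - \<iota> r) and then to 2 x \<otimes> (q/2),
  which is x \<otimes> q.\<close>

lemma of_modsym_to_modsym:
  assumes "f \<in> carrier (free_module (tensor_gens (M2_minus N)))"
  shows "tcs (of_modsym N (to_modsym N f)) = tcs f"
  using assms[unfolded carrier_free_module]
proof (induction f rule: frag_induction)
  case zero
  show ?case using of_modsym_diff[of 0 0] by (simp add: to_modsym_zero)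
next
  case (one p)
  obtain x q where p: "p = (x, q)" by force
  have x: "x \<in> carrier (M2_minus N)" using one by (simp add: p tensor_gens_def)
  note r = symbol_rep[OF x]
  have "tcs (of_modsym N (to_modsym N (gen (x, q))))
      = tcs (gen (2 \<odot>\<^bsub>M2_minus N\<^esub> x, q / 2))"
    using of_modsym_of_int_coeffs[OF antisym_part_closed[OF N r(1)], of q]
    by (simp add: to_modsym_gen antisym_part_of_int_coeffs mcoset_antisym_part[OF r(1)] r(2))
  then show ?case using tcoset_smult[OF module_M2_minus[OF N] x, of 2 "q / 2"] by (simp add: p)
next
  case (diff f g)
  then show ?case using tens_cong(2)[OF diff] by (simp add: to_modsym_diff of_modsym_diff)
qed

text \<open>The right-hand side is the projector onto the (-1)-eigenspace. It is reached symbol by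
  symbol, once each chosen representative has been replaced by the symbol itself.\<close>

lemma to_modsym_of_modsym:
  assumes "g \<in> carrier (free_module (symbols N))"
  shows "coset (symbols N) (modsym_rels N) (to_modsym N (of_modsym N g))
    = coset (symbols N) (modsym_rels N) (scale (1 / 2) (antisym_part N g))"
proof -
  have g: "g = (\<Sum>s\<in>symbols N. scale (Poly_Mapping.lookup g s) (gen s))"
    using assms by (intro poly_mapping_eqI)
      (auto simp: lookup_sum lookup_scale lookup_single when_def finite_symbols in_keys_iff free_module_def
        if_distrib cong: if_cong)
  have sum: "antisym_part N (sum h I) = (\<Sum>i\<in>I. antisym_part N (h i))" for h and I :: "(int \<times> int) set"
    by (simp add: antisym_part_def free_map_sum sum_subtractf)
  have "coset (symbols N) (modsym_rels N) (to_modsym N (of_modsym N g)) = coset (symbols N) (modsym_rels N)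
     (\<Sum>s\<in>symbols N. scale (Poly_Mapping.lookup g s / 2) (antisym_part N (of_int_coeffs (gen s))))"
    unfolding of_modsym_def to_modsym_sum to_modsym_gen
  proof (rule coset_sum_cong[OF modsym_rels_carrier[OF N]], rule coset_eqI[OF modsym_rels_carrier[OF N]])
    fix s assume "s \<in> symbols N"
    then have "mcoset N (symbol_rep N (mcoset N (gen s))) = mcoset N (gen s)"
      by (intro symbol_rep mcoset_closed gen_in_free_module)
    \<comment> \<open>The representative picked for the class of s need not be s, but the error is a
      relation of M_2^-.\<close>
    then have "symbol_rep N (mcoset N (gen s)) - gen s \<in> rel_span (symbols N) (M2_minus_rels N)"
      by (simp add: coset_eq_iff[OF M2_minus_rels_carrier[OF N]])
    from rel_span_scale[OF modsym_rels_carrier[OF N] antisym_part_M2_minus_span[OF N this],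
        of "Poly_Mapping.lookup g s / 2"]
    show "scale (Poly_Mapping.lookup g s / 2) (antisym_part N (of_int_coeffs (symbol_rep N (mcoset N (gen s)))))
        - scale (Poly_Mapping.lookup g s / 2) (antisym_part N (of_int_coeffs (gen s)))
        \<in> rel_span (symbols N) (modsym_rels N)"
      by (simp add: of_int_coeffs_simps antisym_part_simps scale_simps)
  qed
  also have "(\<Sum>s\<in>symbols N. scale (Poly_Mapping.lookup g s / 2) (antisym_part N (of_int_coeffs (gen s))))
      = scale (1 / 2) (antisym_part N g)"
    unfolding arg_cong[OF g, of "antisym_part N"] sum
    by (simp only: antisym_part_simps scale_sum scale_simps(7) of_int_coeffs_simps of_int_1) simp
  finally show ?thesis .
qed

section \<open>The (-1)-eigenspace in terms of representatives\<close>

lemma modsym_carrier: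
  "carrier (modsym N) = coset (symbols N) (modsym_rels N) ` carrier (free_module (symbols N))"
  unfolding modsym_def by (rule presented_module_carrier[OF modsym_rels_carrier[OF N]])

lemmas modsym_ops =
  presented_module_add[OF modsym_rels_carrier[OF N], folded modsym_def]
  presented_module_smult[OF modsym_rels_carrier[OF N], folded modsym_def]
  presented_module_uminus[OF modsym_rels_carrier[OF N], folded modsym_def]
  presented_module_zero[OF modsym_rels_carrier[OF N], folded modsym_def]

lemma modsym_minus_carrier:
  "carrier (modsym_minus N) = coset (symbols N) (modsym_rels N) `
     {g \<in> carrier (free_module (symbols N)). g + iota N g \<in> rel_span (symbols N) (modsym_rels N)}"
proof -
  have "modsym_iota N (coset (symbols N) (modsym_rels N) g) = \<ominus>\<^bsub>modsym N\<^esub> coset (symbols N) (modsym_rels N) g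
      \<longleftrightarrow> g + iota N g \<in> rel_span (symbols N) (modsym_rels N)"
    if "g \<in> carrier (free_module (symbols N))" for g
    using that by (simp add: modsym_iota_coset[OF N] modsym_ops coset_eq_iff[OF modsym_rels_carrier[OF N]]
        add.commute)
  then show ?thesis unfolding modsym_minus_def by (auto simp: modsym_carrier)
qed

lemma module_modsym_minus: "module (ring_of_type_algebra :: rat ring) (modsym_minus N)"
proof -
  interpret module "ring_of_type_algebra :: rat ring" "modsym N" by (rule module_modsym[OF N])
  note rc = modsym_rels_carrier[OF N]
  have "submodule (ring_of_type_algebra :: rat ring) (carrier (modsym_minus N)) (modsym N)"
  proof (unfold_locales, goal_cases)
    case 1
    then show ?case by (auto simp: modsym_minus_carrier modsym_carrier)
  next
    case (2 v w)
    then obtain f g where "f \<in> carrier (free_module (symbols N))" "g \<in> carrier (free_module (symbols N))"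
        "v = coset (symbols N) (modsym_rels N) f" "w = coset (symbols N) (modsym_rels N) g"
        "f + iota N f \<in> rel_span (symbols N) (modsym_rels N)"
        "g + iota N g \<in> rel_span (symbols N) (modsym_rels N)"
      by (auto simp: modsym_minus_carrier)
    then show ?case
      using rel_span_closed(1)[OF rc, of "f + iota N f" "g + iota N g"]
      by (auto simp: modsym_minus_carrier modsym_ops free_map_add free_module_closed algebra_simps
          intro!: imageI)
  next
    case 3
    then show ?case
      by (auto simp: modsym_minus_carrier modsym_ops free_module_zero rel_span_zero[OF rc] intro!: imageI)
  next
    case (4 c v)
    then obtain f where "f \<in> carrier (free_module (symbols N))" "v = coset (symbols N) (modsym_rels N) f"
        "f + iota N f \<in> rel_span (symbols N) (modsym_rels N)"
      by (auto simp: modsym_minus_carrier)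
    then show ?case
      using rel_span_scale[OF rc, of "f + iota N f" c]
      by (auto simp: modsym_minus_carrier modsym_ops free_map_smult free_module_scale scale_simps intro!: imageI)
  qed
  from submodule_is_module[OF this] show ?thesis by (simp add: modsym_minus_def)
qed

end

theorem proposition28:
  fixes N :: nat
  assumes "N \<ge> 2"
  shows "\<exists>T. linear_map (ring_of_type_algebra :: rat ring)
               (tensor_rat (M2_minus N)) (modsym_minus N) T
           \<and> bij_betw T (carrier (tensor_rat (M2_minus N))) (carrier (modsym_minus N))"
proof -
  let ?K = "ring_of_type_algebra :: rat ring" and ?V = "tensor_rat (M2_minus N)"
  let ?F = "free_module (tensor_gens (M2_minus N)) :: (int, _) module"
  let ?t = "tcoset (M2_minus N)" and ?c = "coset (symbols N) (modsym_rels N)"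
  note M = module_M2_minus[OF assms]
  note rc = modsym_rels_carrier[OF assms]
  \<comment> \<open>The chosen preimage is harmless: two candidates differ by a tensor relation,
    which \<open>to_modsym\<close> sends into the span of the modular symbol relations.\<close>
  define T where "T C = ?c (to_modsym N (SOME f. f \<in> carrier ?F \<and> ?t f = C))" for C
  have T: "T (?t f) = ?c (to_modsym N f)" if f: "f \<in> carrier ?F" for f
  proof -
    define g where "g = (SOME g. g \<in> carrier ?F \<and> ?t g = ?t f)"
    have "?t g = ?t f" using someI[of "\<lambda>g. g \<in> carrier ?F \<and> ?t g = ?t f" f] f by (simp add: g_def)
    then have "to_modsym N (g - f) \<in> rel_span (symbols N) (modsym_rels N)"
      by (intro to_modsym_tensor_span[OF assms]) (simp add: tensor_coset_eq_iff[OF M])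
    then show ?thesis by (simp add: T_def g_def[symmetric] to_modsym_diff coset_eq_iff[OF rc])
  qed
  have closed: "to_modsym N f \<in> carrier (free_module (symbols N))"
    and minus: "to_modsym N f + iota N (to_modsym N f) = 0" if "f \<in> carrier ?F" for f
    using to_modsym_closed_iota[OF assms that] by auto
  have range: "T C \<in> carrier (modsym_minus N)" if "C \<in> carrier ?V" for C
    using that
    by (auto simp: tensor_rat_carrier[OF M] T modsym_minus_carrier[OF assms] closed minus rel_span_zero[OF rc]
        intro!: imageI)
  have "linear_map ?K ?V (modsym_minus N) T"
    unfolding linear_map_def vectorspace_def mod_hom_def mod_hom_axioms_def module_hom_def
  proof (intro conjI CollectI allI impI module_tensor_rat[OF M] module_modsym_minus[OF assms]
      field_from_type_algebra)
    show "T \<in> carrier ?V \<rightarrow> carrier (modsym_minus N)" using range by blast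
  next
    fix x y assume "x \<in> carrier ?V \<and> y \<in> carrier ?V"
    then obtain f g where f: "f \<in> carrier ?F" "x = ?t f" and g: "g \<in> carrier ?F" "y = ?t g"
      by (auto simp: tensor_rat_carrier[OF M])
    then show "T (x \<oplus>\<^bsub>?V\<^esub> y) = T x \<oplus>\<^bsub>modsym_minus N\<^esub> T y"
      by (simp add: tensor_rat_add[OF M] T free_module_closed modsym_minus_def modsym_ops[OF assms]
          closed to_modsym_add)
  next
    fix q x assume "q \<in> carrier ?K \<and> x \<in> carrier ?V"
    then obtain f where f: "f \<in> carrier ?F" "x = ?t f"
      by (auto simp: tensor_rat_carrier[OF M])
    then show "T (q \<odot>\<^bsub>?V\<^esub> x) = q \<odot>\<^bsub>modsym_minus N\<^esub> T x"
      by (simp add: tensor_rat_smult_coset[OF M] T act_rat_closed[OF M] modsym_minus_def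
          modsym_ops[OF assms] closed to_modsym_act_rat)
  qed
  moreover have "inj_on T (carrier ?V)"
  proof (rule inj_onI)
    fix x y assume "x \<in> carrier ?V" "y \<in> carrier ?V" and eq: "T x = T y"
    then obtain f g where f: "f \<in> carrier ?F" "x = ?t f" and g: "g \<in> carrier ?F" "y = ?t g"
      by (auto simp: tensor_rat_carrier[OF M])
    have fg: "f - g \<in> carrier ?F" using f g by (intro free_module_closed)
    have "to_modsym N (f - g) \<in> rel_span (symbols N) (modsym_rels N)"
      using eq f g by (simp add: T coset_eq_iff[OF rc] to_modsym_diff)
    \<comment> \<open>The map back kills that span, yet it returns the class of
      \<open>f - g\<close>.\<close>
    then have "?t (f - g) = ?t 0"
      using of_modsym_modsym_span[OF assms] of_modsym_to_modsym[OF assms fg] by simp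
    then show "x = y" by (simp add: f g tensor_coset_eq_iff[OF M])
  qed
  moreover have "carrier (modsym_minus N) \<subseteq> T ` carrier ?V"
  proof
    fix C assume "C \<in> carrier (modsym_minus N)"
    then obtain g where g: "g \<in> carrier (free_module (symbols N))" "C = ?c g"
      and ig: "g + iota N g \<in> rel_span (symbols N) (modsym_rels N)"
      by (auto simp: modsym_minus_carrier[OF assms])
    \<comment> \<open>The projector moves g by half of g + \<iota> g, which is a relation when the
      class of g lies in the eigenspace. So \<open>of_modsym N g\<close> represents a
      preimage.\<close>
    have "scale (1 / 2) (antisym_part N g) - g = scale (- (1 / 2)) (g + iota N g)"
      by (rule poly_mapping_eqI) (simp add: antisym_part_def lookup_scale lookup_add lookup_minus field_simps)
    then have "?c (scale (1 / 2) (antisym_part N g)) = C"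
      using rel_span_scale[OF rc ig, of "- (1 / 2)"] by (simp add: g coset_eq_iff[OF rc])
    then have "C = T (?t (of_modsym N g))"
      by (simp add: T of_modsym_closed[OF assms] to_modsym_of_modsym[OF assms g(1)])
    then show "C \<in> T ` carrier ?V"
      using of_modsym_closed[OF assms, of g] by (auto simp: tensor_rat_carrier[OF M])
  qed
  ultimately show ?thesis
    using range by (intro exI[of _ T]) (auto simp: bij_betw_def)
qed

end
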